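(* Let $G$ be a simply connected real Lie group and let $X$ be a left invariant vector field on $G$. If $K$ is an arbitrary compact subgroup of $Aut_X(G)$, then there exists a left invariant $(\alpha,\beta)$-metric $F$ on $G$ such that $K\subset Aut_X(G)\cap I(G,F)$, where $F$ is defined by the left invariant vector field $X$, a left invariant Riemannian metric $\langle\cdot,\cdot\rangle$ on $G$, and a one-to-one map $\phi:(-b_0,b_0)\to(0,\infty)$ such that $\sqrt{\langle X,X\rangle}<b_0$.
   Context: Left invariant $(\alpha,\beta)$-metric: let $\phi:(-b_0,b_0)\to(0,\infty)$ be a positive smooth function ($b_0>0$) with $\phi(s)-s\phi'(s)+(b^2-s^2)\phi''(s)>0$ for all $|s|\le b<b_0$. Given a left invariant Riemannian metric $\langle\cdot,\cdot\rangle$ and a left invariant vector field $X$ on $G$ with $\sqrt{\langle X,X\rangle}<b_0$, the $(\alpha,\beta)$-metric defined by $X$, $\langle\cdot,\cdot\rangle$ and $\phi$ is the Finsler metric $$F(h,Y_h)=\sqrt{\langle Y_h,Y_h\rangle}\;\phi\!\left(\frac{\langle X_h,Y_h\rangle}{\sqrt{\langle Y_h,Y_h\rangle}}\right),\qquad h\in G,\ 0\ne Y_h\in T_hG,$$ with $F(h,0)=0$. $Aut(G)$ is the group of automorphisms of the Lie group $G$, with the Lie group structure for which $\psi\mapsto d\psi_e$ is an isomorphism $Aut(G)\to Aut(\mathfrak{g})$ of Lie groups ($\mathfrak{g}$ the Lie algebra of $G$). For $\psi\in Aut(G)$, the vector field $X$ is $\psi$-invariant if $d\psi\circ X=X\circ\psi$.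 $Aut_X(G)=\{\psi\in Aut(G)\mid X \text{ is } \psi\text{-invariant}\}$. $I(G,F)$ is the isometry group of the Finsler manifold $(G,F)$, i.e. the group of diffeomorphisms $\psi$ of $G$ with $F(\psi(g),d\psi_gY_g)=F(g,Y_g)$ for all $g\in G$, $Y_g\in T_gG$. *)

theory Defs
  imports "HOL-Analysis.Analysis" "HOL-Algebra.Bij"
begin

section \<open>Smooth functions between normed spaces\<close>

text \<open>
  Iterating directional derivatives keeps the codomain type fixed. For an open subset of a
  finite-dimensional space, which is the only case used below, this is the usual class of
  \<open>k\<close> times continuously differentiable functions.
\<close>

primrec Ck_on :: "nat \<Rightarrow> ('a::real_normed_vector \<Rightarrow> 'b::real_normed_vector) \<Rightarrow> 'a set \<Rightarrow> bool" where
  "Ck_on 0 f S \<longleftrightarrow> continuous_on S f"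
| "Ck_on (Suc k) f S \<longleftrightarrow>
     (\<forall>x\<in>S. f differentiable (at x)) \<and>
     (\<forall>v. Ck_on k (\<lambda>x. frechet_derivative f (at x) v) S)"

definition smooth_on :: "'a::real_normed_vector set \<Rightarrow> ('a \<Rightarrow> 'b::real_normed_vector) \<Rightarrow> bool" where
  "smooth_on S f \<longleftrightarrow> (\<forall>k. Ck_on k f S)"


section \<open>Manifolds and tangent vectors\<close>

text \<open>
  The manifold is the whole type \<open>'g\<close>; a chart is a domain together with a coordinate map into
  the model space \<open>'e\<close>. The model space is a finite-dimensional real inner product space, i.e.
  a Euclidean space. The class \<open>euclidean_space\<close> is avoided because it excludes dimension 0.
\<close>

type_synonym ('g, 'e) chart = "'g set \<times> ('g \<Rightarrow> 'e)"

definition chart_inv :: "('g, 'e) chart \<Rightarrow> 'e \<Rightarrow> 'g" where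
  "chart_inv \<kappa> = inv_into (fst \<kappa>) (snd \<kappa>)"

definition smooth_atlas ::
    "('g::{t2_space,second_countable_topology}, 'e::real_inner) chart set \<Rightarrow> bool" where
  "smooth_atlas A \<longleftrightarrow>
     (\<exists>B::'e set. finite B \<and> span B = UNIV) \<and>
     (\<Union>\<kappa>\<in>A. fst \<kappa>) = UNIV \<and>
     (\<forall>\<kappa>\<in>A. open (fst \<kappa>) \<and> open (snd \<kappa> ` fst \<kappa>) \<and>
        homeomorphism (fst \<kappa>) (snd \<kappa> ` fst \<kappa>) (snd \<kappa>) (chart_inv \<kappa>)) \<and>
     (\<forall>\<kappa>\<in>A. \<forall>\<mu>\<in>A. smooth_on (snd \<kappa> ` (fst \<kappa> \<inter> fst \<mu>)) (snd \<mu> \<circ> chart_inv \<kappa>))"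

definition prod_atlas ::
    "('g, 'e) chart set \<Rightarrow> ('h, 'f) chart set \<Rightarrow> ('g \<times> 'h, 'e \<times> 'f) chart set" where
  "prod_atlas A B =
     {(fst \<kappa> \<times> fst \<mu>, map_prod (snd \<kappa>) (snd \<mu>)) | \<kappa> \<mu>. \<kappa> \<in> A \<and> \<mu> \<in> B}"

definition local_rep ::
    "('g, 'e) chart \<Rightarrow> ('h, 'f) chart \<Rightarrow> ('g \<Rightarrow> 'h) \<Rightarrow> 'e \<Rightarrow> 'f" where
  "local_rep \<kappa> \<mu> f = snd \<mu> \<circ> f \<circ> chart_inv \<kappa>"

definition smooth_map ::
    "('g::topological_space, 'e::real_normed_vector) chart set \<Rightarrow>
     ('h::topological_space, 'f::real_normed_vector) chart set \<Rightarrow> ('g \<Rightarrow> 'h) \<Rightarrow> bool" where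
  "smooth_map A B f \<longleftrightarrow> continuous_on UNIV f \<and>
     (\<forall>\<kappa>\<in>A. \<forall>\<mu>\<in>B. smooth_on (snd \<kappa> ` (fst \<kappa> \<inter> f -` fst \<mu>)) (local_rep \<kappa> \<mu> f))"

definition diffeomorphism ::
    "('g::topological_space, 'e::real_normed_vector) chart set \<Rightarrow> ('g \<Rightarrow> 'g) \<Rightarrow> bool" where
  "diffeomorphism A f \<longleftrightarrow> bij f \<and> smooth_map A A f \<and> smooth_map A A (inv_into UNIV f)"

text \<open>
  A tangent vector at \<open>p\<close> is a class of pairs (chart around \<open>p\<close>, components), two pairs being
  identified when the derivative of the transition map carries one to the other. Every such class
  has exactly one representative for the chart \<open>chart_at A p\<close>, and it is recorded by its
  components there. So every tangent space is carried by the type \<open>'e\<close>, with the vector space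
  structure of \<open>'e\<close> (the inner product of \<open>'e\<close> plays no role on tangent spaces).
  \<open>change_chart\<close> converts components between charts.
\<close>

definition chart_at :: "('g, 'e) chart set \<Rightarrow> 'g \<Rightarrow> ('g, 'e) chart" where
  "chart_at A p = (SOME \<kappa>. \<kappa> \<in> A \<and> p \<in> fst \<kappa>)"

definition change_chart ::
    "('g, 'e::real_normed_vector) chart \<Rightarrow> ('g, 'e) chart \<Rightarrow> 'g \<Rightarrow> 'e \<Rightarrow> 'e" where
  "change_chart \<kappa> \<mu> p = frechet_derivative (local_rep \<kappa> \<mu> id) (at (snd \<kappa> p))"

text \<open>The differential of \<open>f\<close> at \<open>p\<close>, from the tangent space at \<open>p\<close> to that at \<open>f p\<close>:\<close>

definition tangent_map ::
    "('g, 'e::real_normed_vector) chart set \<Rightarrow> ('h, 'f::real_normed_vector) chart set \<Rightarrow>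
     ('g \<Rightarrow> 'h) \<Rightarrow> 'g \<Rightarrow> 'e \<Rightarrow> 'f" where
  "tangent_map A B f p =
     frechet_derivative (local_rep (chart_at A p) (chart_at B (f p)) f) (at (snd (chart_at A p) p))"

definition smooth_vector_field ::
    "('g, 'e::real_normed_vector) chart set \<Rightarrow> ('g \<Rightarrow> 'e) \<Rightarrow> bool" where
  "smooth_vector_field A X \<longleftrightarrow>
     (\<forall>\<kappa>\<in>A. smooth_on (snd \<kappa> ` fst \<kappa>)
        (\<lambda>x. let p = chart_inv \<kappa> x in change_chart (chart_at A p) \<kappa> p (X p)))"

text \<open>
  Smoothness of a metric: in each chart, the values on pairs of vector fields with constant
  components \<open>u\<close> and \<open>v\<close> in that chart are smooth.
\<close>

definition riemannian_metric ::
    "('g, 'e::real_normed_vector) chart set \<Rightarrow> ('g \<Rightarrow> 'e \<Rightarrow> 'e \<Rightarrow> real) \<Rightarrow> bool" where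
  "riemannian_metric A g \<longleftrightarrow>
     (\<forall>p. bilinear (g p) \<and> (\<forall>u v. g p u v = g p v u) \<and> (\<forall>u. u \<noteq> 0 \<longrightarrow> g p u u > 0)) \<and>
     (\<forall>\<kappa>\<in>A. \<forall>u v. smooth_on (snd \<kappa> ` fst \<kappa>)
        (\<lambda>x. let p = chart_inv \<kappa> x; T = change_chart \<kappa> (chart_at A p) p in g p (T u) (T v)))"


section \<open>Lie groups and left invariant structures\<close>

definition lie_group ::
    "('g::{t2_space,second_countable_topology}, 'm) monoid_scheme \<Rightarrow>
     ('g, 'e::real_inner) chart set \<Rightarrow> bool" where
  "lie_group G A \<longleftrightarrow> group G \<and> carrier G = UNIV \<and> smooth_atlas A \<and>
     smooth_map (prod_atlas A A) A (\<lambda>(x, y). x \<otimes>\<^bsub>G\<^esub> y) \<and>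
     smooth_map A A (\<lambda>x. inv\<^bsub>G\<^esub> x)"

definition left_translation :: "('g, 'm) monoid_scheme \<Rightarrow> 'g \<Rightarrow> 'g \<Rightarrow> 'g" where
  "left_translation G h = (\<lambda>x. h \<otimes>\<^bsub>G\<^esub> x)"

definition left_invariant_vector_field ::
    "('g, 'm) monoid_scheme \<Rightarrow> ('g, 'e::real_normed_vector) chart set \<Rightarrow> ('g \<Rightarrow> 'e) \<Rightarrow> bool" where
  "left_invariant_vector_field G A X \<longleftrightarrow> smooth_vector_field A X \<and>
     (\<forall>h p. tangent_map A A (left_translation G h) p (X p) = X (h \<otimes>\<^bsub>G\<^esub> p))"

definition left_invariant_riemannian_metric ::
    "('g, 'm) monoid_scheme \<Rightarrow> ('g, 'e::real_normed_vector) chart set \<Rightarrow>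
     ('g \<Rightarrow> 'e \<Rightarrow> 'e \<Rightarrow> real) \<Rightarrow> bool" where
  "left_invariant_riemannian_metric G A g \<longleftrightarrow> riemannian_metric A g \<and>
     (\<forall>h p u v. g (h \<otimes>\<^bsub>G\<^esub> p) (tangent_map A A (left_translation G h) p u)
                            (tangent_map A A (left_translation G h) p v) = g p u v)"


section \<open>Left invariant \<open>(\<alpha>,\<beta>)\<close>-metrics and their isometries\<close>

text \<open>The positive smooth functions on \<open>(-b0, b0)\<close> for which the formula below is a Finsler metric:\<close>

definition alpha_beta_function :: "real \<Rightarrow> (real \<Rightarrow> real) \<Rightarrow> bool" where
  "alpha_beta_function b0 \<phi> \<longleftrightarrow> b0 > 0 \<and> smooth_on {-b0<..<b0} \<phi> \<and>
     (\<forall>s\<in>{-b0<..<b0}. \<phi> s > 0) \<and>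
     (\<forall>b s. \<bar>s\<bar> \<le> b \<and> b < b0 \<longrightarrow>
        \<phi> s - s * deriv \<phi> s + (b\<^sup>2 - s\<^sup>2) * deriv (deriv \<phi>) s > 0)"

definition alpha_beta_metric ::
    "('g \<Rightarrow> 'e \<Rightarrow> 'e \<Rightarrow> real) \<Rightarrow> ('g \<Rightarrow> 'e::zero) \<Rightarrow> (real \<Rightarrow> real) \<Rightarrow> 'g \<Rightarrow> 'e \<Rightarrow> real" where
  "alpha_beta_metric g X \<phi> h y =
     (if y = 0 then 0 else sqrt (g h y y) * \<phi> (g h (X h) y / sqrt (g h y y)))"

definition left_invariant_alpha_beta_metric ::
    "('g, 'm) monoid_scheme \<Rightarrow> ('g, 'e::real_normed_vector) chart set \<Rightarrow> ('g \<Rightarrow> 'e) \<Rightarrow>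
     ('g \<Rightarrow> 'e \<Rightarrow> 'e \<Rightarrow> real) \<Rightarrow> real \<Rightarrow> (real \<Rightarrow> real) \<Rightarrow> ('g \<Rightarrow> 'e \<Rightarrow> real) \<Rightarrow> bool" where
  "left_invariant_alpha_beta_metric G A X g b0 \<phi> F \<longleftrightarrow>
     left_invariant_vector_field G A X \<and> left_invariant_riemannian_metric G A g \<and>
     alpha_beta_function b0 \<phi> \<and> (\<forall>h. sqrt (g h (X h) (X h)) < b0) \<and>
     F = alpha_beta_metric g X \<phi>"

definition isometry_set ::
    "('g::topological_space, 'e::real_normed_vector) chart set \<Rightarrow> ('g \<Rightarrow> 'e \<Rightarrow> real) \<Rightarrow>
     ('g \<Rightarrow> 'g) set" where
  "isometry_set A F =
     {\<psi>. diffeomorphism A \<psi> \<and> (\<forall>p y. F (\<psi> p) (tangent_map A A \<psi> p y) = F p y)}"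


section \<open>Automorphisms of a Lie group\<close>

text \<open>
  The group operation on these sets of maps is that of the library's \<open>AutoGroup G\<close>
  (composition).
\<close>

definition lie_aut ::
    "('g::topological_space, 'm) monoid_scheme \<Rightarrow> ('g, 'e::real_normed_vector) chart set \<Rightarrow>
     ('g \<Rightarrow> 'g) set" where
  "lie_aut G A = {\<psi> \<in> auto G. diffeomorphism A \<psi>}"

definition lie_aut_fixing ::
    "('g::topological_space, 'm) monoid_scheme \<Rightarrow> ('g, 'e::real_normed_vector) chart set \<Rightarrow>
     ('g \<Rightarrow> 'e) \<Rightarrow> ('g \<Rightarrow> 'g) set" where
  "lie_aut_fixing G A X =
     {\<psi> \<in> lie_aut G A. \<forall>p. tangent_map A A \<psi> p (X p) = X (\<psi> p)}"

text \<open>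
  The topology of \<open>Aut(G)\<close> underlying its Lie group structure: \<open>\<psi> \<mapsto> d\<psi>\<^sub>e\<close> is an isomorphism onto
  \<open>Aut(\<gg>)\<close>, which carries the subspace topology of the linear endomorphisms of \<open>T\<^sub>eG\<close>.
\<close>

definition lie_aut_topology ::
    "('g::topological_space, 'm) monoid_scheme \<Rightarrow> ('g, 'e::real_normed_vector) chart set \<Rightarrow>
     ('g \<Rightarrow> 'g) topology" where
  "lie_aut_topology G A =
     pullback_topology (lie_aut G A) (\<lambda>\<psi>. Blinfun (tangent_map A A \<psi> \<one>\<^bsub>G\<^esub>)) euclidean"

end

theory Submission
  imports Defs
begin

text \<open>
  The differentials at the identity of the elements of \<open>K\<close> form a compact group of linear maps of the
  Lie algebra, so they preserve some inner product \<open>q\<close>. Its left translates form a left invariant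
  Riemannian metric, and every \<open>\<psi> \<in> K\<close> is an isometry of it, because \<open>\<psi>\<close> intertwines the left
  translations by \<open>h\<close> and by \<open>\<psi> h\<close>, which reduces the claim to the identity element. As \<open>\<psi>\<close> also
  preserves \<open>X\<close>, it preserves every \<open>(\<alpha>,\<beta>)\<close>-metric built from \<open>X\<close> and this Riemannian metric. The
  length of \<open>X\<close> is constant, so the Randers type function \<open>\<phi> s = b + s\<close> with \<open>b\<close> larger than this
  length is admissible, and it is injective.
\<close>

subsection \<open>Calculus of \<open>C\<^sup>k\<close> functions\<close>

lemma Ck_on_imp_differentiable: "Ck_on (Suc k) f S \<Longrightarrow> x \<in> S \<Longrightarrow> f differentiable (at x)"
  by simp

lemma Ck_on_SucD: "Ck_on (Suc k) f S \<Longrightarrow> Ck_on k f S"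
proof (induction k arbitrary: f)
  case 0
  then show ?case
    by (auto intro!: continuous_at_imp_continuous_on differentiable_imp_continuous_within)
next
  case (Suc k)
  then show ?case by (simp del: Ck_on.simps(1))
qed

text \<open>\<open>frechet_derivative\<close> looks at a full neighbourhood of the point, so
  equality on \<open>S\<close> passes to the derivatives because \<open>S\<close> is open.\<close>

lemma Ck_on_cong:
  assumes "open S" "\<And>x. x \<in> S \<Longrightarrow> f x = g x" "Ck_on k f S"
  shows "Ck_on k g S"
  using assms(2,3)
proof (induction k arbitrary: f g)
  case 0
  then show ?case by (simp cong: continuous_on_cong)
next
  case (Suc k)
  have diff: "f differentiable (at x)" if "x \<in> S" for x
    using Suc.prems that by simp
  have D: "(g has_derivative frechet_derivative f (at x)) (at x)" if "x \<in> S" for x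
    using diff[OF that] Suc.prems(1) has_derivative_transform_within_open[OF _ assms(1) that]
    unfolding frechet_derivative_works by blast
  then have "Ck_on k (\<lambda>x. frechet_derivative g (at x) v) S" for v
    using Suc.IH[of "\<lambda>x. frechet_derivative f (at x) v"] Suc.prems(2) frechet_derivative_at[OF D]
    by simp
  then show ?case using D unfolding Ck_on.simps differentiable_def by blast
qed

lemma Ck_on_local:
  assumes "\<And>x. x \<in> S \<Longrightarrow> \<exists>U. open U \<and> x \<in> U \<and> Ck_on k f U"
  shows "Ck_on k f S"
  using assms
proof (induction k arbitrary: f)
  case 0
  show ?case
    unfolding Ck_on.simps
  proof (intro continuous_at_imp_continuous_on ballI)
    fix x assume "x \<in> S"
    then obtain U where "open U" "x \<in> U" "continuous_on U f" using 0 by auto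
    then show "isCont f x" by (simp add: continuous_on_eq_continuous_at)
  qed
next
  case (Suc k)
  then have "Ck_on k (\<lambda>x. frechet_derivative f (at x) v) S" for v
    by (metis Ck_on.simps(2))
  then show ?case using Suc.prems by (metis Ck_on.simps(2))
qed

lemma Ck_on_const: "Ck_on k (\<lambda>x. c) S"
  by (induction k arbitrary: c) simp_all

lemma Ck_on_bounded_linear:
  assumes "bounded_linear l"
  shows "Ck_on k l S"
proof (cases k)
  case (Suc n)
  have "(l has_derivative l) (at x)" for x
    using assms by (rule bounded_linear_imp_has_derivative)
  then have "frechet_derivative l (at x) = l" "l differentiable (at x)" for x
    by (auto simp: differentiable_def dest: frechet_derivative_at[symmetric])
  then show ?thesis by (simp add: Suc Ck_on_const)
qed (simp add: assms linear_continuous_on)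

lemma Ck_on_add:
  assumes "open S" "Ck_on k f S" "Ck_on k g S"
  shows "Ck_on k (\<lambda>x. f x + g x) S"
  using assms(2,3)
proof (induction k arbitrary: f g)
  case 0
  then show ?case by (simp add: continuous_on_add)
next
  case (Suc k)
  have D: "((\<lambda>x. f x + g x) has_derivative
      (\<lambda>v. frechet_derivative f (at x) v + frechet_derivative g (at x) v)) (at x)" if "x \<in> S" for x
    using Suc.prems that
    by (intro has_derivative_add) (simp_all flip: frechet_derivative_works)
  have "Ck_on k (\<lambda>x. frechet_derivative (\<lambda>x. f x + g x) (at x) v) S" for v
    by (rule Ck_on_cong[OF assms(1) _ Suc.IH[of "\<lambda>x. frechet_derivative f (at x) v"
            "\<lambda>x. frechet_derivative g (at x) v"]])
      (use Suc.prems in \<open>simp_all flip: frechet_derivative_at[OF D]\<close>)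
  then show ?case using D unfolding Ck_on.simps differentiable_def by blast
qed

lemma Ck_on_sum:
  assumes "open S" "\<And>i. i \<in> I \<Longrightarrow> Ck_on k (f i) S"
  shows "Ck_on k (\<lambda>x. \<Sum>i\<in>I. f i x) S"
  using assms(2)
proof (induction I rule: infinite_finite_induct)
  case (insert i I)
  then show ?case by (simp add: Ck_on_add[OF assms(1)])
qed (simp_all add: Ck_on_const)

text \<open>By the Leibniz rule the derivative is a sum of two terms of the same shape, each with
  one factor differentiated. The other factor is lowered from order \<open>Suc k\<close> to
  \<open>k\<close> by \<open>Ck_on_SucD\<close>.\<close>

lemma Ck_on_bounded_bilinear:
  assumes "bounded_bilinear B" "open S" "Ck_on k f S" "Ck_on k g S"
  shows "Ck_on k (\<lambda>x. B (f x) (g x)) S"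
  using assms(3,4)
proof (induction k arbitrary: f g)
  case 0
  then show ?case by (simp add: bounded_bilinear.continuous_on[OF assms(1)])
next
  case (Suc k)
  have D: "((\<lambda>x. B (f x) (g x)) has_derivative
      (\<lambda>v. B (f x) (frechet_derivative g (at x) v) + B (frechet_derivative f (at x) v) (g x))) (at x)"
    if "x \<in> S" for x
    using Suc.prems that
    by (intro bounded_bilinear.FDERIV[OF assms(1)]) (simp_all flip: frechet_derivative_works)
  have "Ck_on k (\<lambda>x. frechet_derivative (\<lambda>x. B (f x) (g x)) (at x) v) S" for v
  proof (rule Ck_on_cong[OF assms(2)])
    show "Ck_on k (\<lambda>x. B (f x) (frechet_derivative g (at x) v)
        + B (frechet_derivative f (at x) v) (g x)) S"
      using Suc.prems Ck_on_SucD[OF Suc.prems(1)] Ck_on_SucD[OF Suc.prems(2)]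
      by (intro Ck_on_add assms(2) Suc.IH) simp_all
  qed (simp flip: frechet_derivative_at[OF D])
  then show ?case using D unfolding Ck_on.simps differentiable_def by blast
qed

lemma Ck_on_Pair:
  assumes "open S" "Ck_on k f S" "Ck_on k g S"
  shows "Ck_on k (\<lambda>x. (f x, g x)) S"
  using assms(2,3)
proof (induction k arbitrary: f g)
  case 0
  then show ?case by (simp add: continuous_on_Pair)
next
  case (Suc k)
  have D: "((\<lambda>x. (f x, g x)) has_derivative
      (\<lambda>v. (frechet_derivative f (at x) v, frechet_derivative g (at x) v))) (at x)" if "x \<in> S" for x
    using Suc.prems that
    by (intro has_derivative_Pair) (simp_all flip: frechet_derivative_works)
  have "Ck_on k (\<lambda>x. frechet_derivative (\<lambda>x. (f x, g x)) (at x) v) S" for v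
    by (rule Ck_on_cong[OF assms(1) _ Suc.IH[of "\<lambda>x. frechet_derivative f (at x) v"
            "\<lambda>x. frechet_derivative g (at x) v"]])
      (use Suc.prems in \<open>simp_all flip: frechet_derivative_at[OF D]\<close>)
  then show ?case using D unfolding Ck_on.simps differentiable_def by blast
qed

text \<open>The difference \<open>?w\<close> is orthogonal to every element of \<open>C\<close>,
  hence to the whole space, hence to itself.\<close>

lemma orthogonal_expansion:
  fixes C :: "'b::real_inner set"
  assumes "finite C" "pairwise orthogonal C" "span C = UNIV"
  shows "(\<Sum>c\<in>C. (v \<bullet> c / (c \<bullet> c)) *\<^sub>R c) = v"
proof -
  let ?w = "v - (\<Sum>c\<in>C. (v \<bullet> c / (c \<bullet> c)) *\<^sub>R c)"
  have "orthogonal ?w d" if d: "d \<in> C" for d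
  proof -
    \<comment> \<open>\<open>C\<close> may contain the zero vector: if \<open>d = 0\<close>, both
      sides are zero.\<close>
    have "(\<Sum>c\<in>C. (v \<bullet> c / (c \<bullet> c)) *\<^sub>R c) \<bullet> d = (\<Sum>c\<in>C. if c = d then v \<bullet> d else 0)"
      unfolding inner_sum_left using assms(2) d
      by (intro sum.cong refl) (auto simp: pairwise_def orthogonal_def)
    then show ?thesis using assms(1) d by (simp add: orthogonal_def inner_diff_left)
  qed
  then have "orthogonal ?w y" if "y \<in> span C" for y
    using orthogonal_to_span[OF that] by blast
  then have "orthogonal ?w ?w" unfolding assms(3) by simp
  then show ?thesis by (simp add: orthogonal_self)
qed

lemma Ck_on_linear_compose:
  assumes "bounded_linear l" "open S" "Ck_on k f S"
  shows "Ck_on k (\<lambda>x. l (f x)) S"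
  using assms(3)
proof (induction k arbitrary: f)
  case 0
  then show ?case by (simp add: bounded_linear.continuous_on[OF assms(1)])
next
  case (Suc k)
  have D: "((\<lambda>x. l (f x)) has_derivative (\<lambda>v. l (frechet_derivative f (at x) v))) (at x)"
    if "x \<in> S" for x
    using Suc.prems that
    by (intro bounded_linear.has_derivative[OF assms(1)]) (simp_all flip: frechet_derivative_works)
  have "Ck_on k (\<lambda>x. frechet_derivative (\<lambda>x. l (f x)) (at x) v) S" for v
    by (rule Ck_on_cong[OF assms(2) _ Suc.IH[of "\<lambda>x. frechet_derivative f (at x) v"]])
      (use Suc.prems in \<open>simp_all flip: frechet_derivative_at[OF D]\<close>)
  then show ?case using D unfolding Ck_on.simps differentiable_def by blast
qed

text \<open>The domain of the outer function has to be finite-dimensional: its derivative is evaluated at a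
  varying vector, and only the derivatives along fixed vectors are known to be of class \<open>C\<^sup>k\<close>.\<close>

lemma Ck_on_compose:
  fixes f :: "'b::real_inner \<Rightarrow> 'c::real_normed_vector" and g :: "'a::real_normed_vector \<Rightarrow> 'b"
  assumes "finite (B :: 'b set)" "span B = UNIV" "open S" "g ` S \<subseteq> T" "Ck_on k f T" "Ck_on k g S"
  shows "Ck_on k (\<lambda>x. f (g x)) S"
proof -
  \<comment> \<open>For an orthogonal spanning set the coordinates are explicit bounded linear
    functionals, the \<open>l c\<close> below.\<close>
  obtain C :: "'b set" where "finite C" "span C = UNIV" "pairwise orthogonal C"
    using basis_orthogonal[OF assms(1)] assms(2) by auto
  note expansion = orthogonal_expansion[OF this(1,3,2)]
  define l where "l c v = v \<bullet> c / (c \<bullet> c)" for c v :: 'b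
  have l: "bounded_linear (l c)" for c
    unfolding l_def by (rule bounded_linear_compose[OF bounded_linear_divide bounded_linear_inner_left])
  show ?thesis
    using assms(5,6)
  proof (induction k arbitrary: f)
    case 0
    then show ?case using continuous_on_compose2[OF _ _ assms(4)] by simp
  next
    case (Suc k)
    have f: "f differentiable (at (g x))" and g: "g differentiable (at x)" if "x \<in> S" for x
      using Suc.prems that assms(4) by auto
    have D: "((\<lambda>x. f (g x)) has_derivative
        (\<lambda>v. frechet_derivative f (at (g x)) (frechet_derivative g (at x) v))) (at x)" if "x \<in> S" for x
      using diff_chain_at[OF g[OF that, unfolded frechet_derivative_works]
          f[OF that, unfolded frechet_derivative_works]] by (simp only: o_def)
    \<comment> \<open>Expanding the inner derivative along \<open>C\<close> leaves only outer
      derivatives in the fixed directions \<open>c\<close>, composed with \<open>g\<close>. The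
      induction hypothesis covers these, and the coordinates are scalar factors of class
      \<open>Ck_on k\<close>.\<close>
    have "Ck_on k (\<lambda>x. frechet_derivative (\<lambda>x. f (g x)) (at x) v) S" for v
    proof (rule Ck_on_cong[OF assms(3)])
      show "Ck_on k (\<lambda>x. \<Sum>c\<in>C. l c (frechet_derivative g (at x) v) *\<^sub>R
          frechet_derivative f (at (g x)) c) S"
      proof (intro Ck_on_sum Ck_on_bounded_bilinear[OF bounded_bilinear_scaleR] assms(3))
        fix c
        show "Ck_on k (\<lambda>x. l c (frechet_derivative g (at x) v)) S"
          using Suc.prems(2) by (intro Ck_on_linear_compose[OF l assms(3)]) simp
        show "Ck_on k (\<lambda>x. frechet_derivative f (at (g x)) c) S"
          using Suc.prems(1) by (intro Suc.IH[OF _ Ck_on_SucD[OF Suc.prems(2)],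
            of "\<lambda>y. frechet_derivative f (at y) c"]) simp
      qed
    next
      fix x assume x: "x \<in> S"
      have lin: "linear (frechet_derivative f (at (g x)))"
        by (rule linear_frechet_derivative[OF f[OF x]])
      have "frechet_derivative f (at (g x)) w = (\<Sum>c\<in>C. l c w *\<^sub>R frechet_derivative f (at (g x)) c)" for w
        using arg_cong[OF expansion[of w], of "frechet_derivative f (at (g x))", symmetric]
        by (simp only: linear_sum[OF lin] linear_cmul[OF lin] l_def)
      then show "(\<Sum>c\<in>C. l c (frechet_derivative g (at x) v) *\<^sub>R frechet_derivative f (at (g x)) c)
          = frechet_derivative (\<lambda>x. f (g x)) (at x) v"
        unfolding frechet_derivative_at[OF D[OF x], symmetric] by (rule sym)
    qed
    then show ?case using D unfolding Ck_on.simps differentiable_def by blast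
  qed
qed

lemma smooth_on_imp_differentiable: "smooth_on S f \<Longrightarrow> x \<in> S \<Longrightarrow> f differentiable (at x)"
  unfolding smooth_on_def by (meson Ck_on_imp_differentiable)

lemma smooth_on_frechet_derivative:
  "smooth_on S f \<Longrightarrow> smooth_on S (\<lambda>x. frechet_derivative f (at x) v)"
  unfolding smooth_on_def using Ck_on.simps(2)[of _ f S] by blast

lemma smooth_on_compose:
  fixes f :: "'b::real_inner \<Rightarrow> 'c::real_normed_vector" and g :: "'a::real_normed_vector \<Rightarrow> 'b"
  assumes "finite (B :: 'b set)" "span B = UNIV" "open S" "g ` S \<subseteq> T" "smooth_on T f" "smooth_on S g"
  shows "smooth_on S (\<lambda>x. f (g x))"
  using Ck_on_compose[OF assms(1-4)] assms(5,6) unfolding smooth_on_def by blast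

lemma smooth_on_Pair:
  "open S \<Longrightarrow> smooth_on S f \<Longrightarrow> smooth_on S g \<Longrightarrow> smooth_on S (\<lambda>x. (f x, g x))"
  unfolding smooth_on_def by (blast intro: Ck_on_Pair)

lemma smooth_on_cong:
  "open S \<Longrightarrow> (\<And>x. x \<in> S \<Longrightarrow> f x = g x) \<Longrightarrow> smooth_on S f \<Longrightarrow> smooth_on S g"
  unfolding smooth_on_def by (blast intro: Ck_on_cong)

lemma smooth_on_local:
  assumes "\<And>x. x \<in> S \<Longrightarrow> \<exists>U. open U \<and> x \<in> U \<and> smooth_on U f"
  shows "smooth_on S f"
  unfolding smooth_on_def
proof (intro allI Ck_on_local)
  fix k x assume "x \<in> S"
  then show "\<exists>U. open U \<and> x \<in> U \<and> Ck_on k f U"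
    using assms unfolding smooth_on_def by meson
qed

lemma smooth_on_const: "smooth_on S (\<lambda>x. c)"
  unfolding smooth_on_def by (blast intro: Ck_on_const)

lemma smooth_on_ident: "smooth_on S (\<lambda>x. x)"
  unfolding smooth_on_def using Ck_on_bounded_linear[OF bounded_linear_ident] by blast

lemma smooth_on_add:
  "open S \<Longrightarrow> smooth_on S f \<Longrightarrow> smooth_on S g \<Longrightarrow> smooth_on S (\<lambda>x. f x + g x)"
  unfolding smooth_on_def by (blast intro: Ck_on_add)

lemma smooth_on_bounded_bilinear:
  "bounded_bilinear B \<Longrightarrow> open S \<Longrightarrow> smooth_on S f \<Longrightarrow> smooth_on S g \<Longrightarrow> smooth_on S (\<lambda>x. B (f x) (g x))"
  unfolding smooth_on_def by (blast intro: Ck_on_bounded_bilinear)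

text \<open>Provides the finite-dimensionality of \<open>'e \<times> 'e\<close>, so that the chain
  rule applies to the group multiplication read in charts.\<close>

lemma span_Times_UNIV:
  fixes B :: "'b::real_inner set" and C :: "'c::real_inner set"
  assumes "finite B" "span B = UNIV" "finite C" "span C = UNIV"
  obtains E :: "('b \<times> 'c) set" where "finite E" "span E = UNIV"
proof (rule that[of "(\<lambda>b. (b, 0)) ` B \<union> Pair 0 ` C"])
  have "linear (\<lambda>b::'b. (b, 0::'c))" "linear (Pair (0::'b) :: 'c \<Rightarrow> _)"
    by (auto intro!: linearI)
  then have "span ((\<lambda>b. (b, 0)) ` B) = range (\<lambda>b. (b, 0::'c))"
    "span (Pair (0::'b) ` C) = range (Pair 0)"
    using assms by (simp_all add: linear_span_image)
  then have "(b, c) \<in> span ((\<lambda>b. (b, 0)) ` B \<union> Pair (0::'b) ` C)" for b c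
    using span_add[of "(b, 0)" _ "(0, c)"]
      span_mono[of "(\<lambda>b. (b, 0)) ` B" "(\<lambda>b. (b, 0)) ` B \<union> Pair (0::'b) ` C"]
      span_mono[of "Pair (0::'b) ` C" "(\<lambda>b. (b, 0)) ` B \<union> Pair (0::'b) ` C"]
    by (simp add: subset_iff)
  then show "span ((\<lambda>b. (b, 0)) ` B \<union> Pair (0::'b) ` C) = UNIV"
    by auto
qed (simp add: assms)

subsection \<open>Inner products invariant under a compact group\<close>

lemma bilinear_eq_on_spanning:
  assumes "bilinear f" "bilinear g" "span B = UNIV" "\<And>b c. b \<in> B \<Longrightarrow> c \<in> B \<Longrightarrow> f b c = g b c"
  shows "f u v = g u v"
  using bilinear_eq[OF assms(1,2), of UNIV B UNIV B] assms(3,4) by simp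

text \<open>Tychonoff: in the topology of pointwise convergence the set is a product of compact
  intervals.\<close>

lemma compact_pointwise_bounded:
  fixes c :: "'a \<Rightarrow> 'b \<Rightarrow> real"
  shows "compact {g :: 'a \<Rightarrow> 'b \<Rightarrow> real. \<forall>u v. \<bar>g u v\<bar> \<le> c u v}"
proof -
  have compact_PiE: "compact (PiE UNIV S)" if "\<And>i. compact (S i)"
    for S :: "'i \<Rightarrow> 'd::topological_space set"
    using that unfolding compactin_euclidean_iff[symmetric]
    by (simp add: compactin_PiE flip: euclidean_product_topology)
  have "{g :: 'a \<Rightarrow> 'b \<Rightarrow> real. \<forall>u v. \<bar>g u v\<bar> \<le> c u v} = (\<Pi>\<^sub>E u\<in>UNIV. \<Pi>\<^sub>E v\<in>UNIV. {- c u v..c u v})"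
    by (auto simp: PiE_def Pi_def abs_le_iff minus_le_iff)
  then show ?thesis by (simp add: compact_PiE)
qed

lemma continuous_evaluation2: "continuous_on UNIV (\<lambda>g :: 'a \<Rightarrow> 'b \<Rightarrow> 'c::topological_space. g u v)"
  by (rule continuous_on_product_then_coordinatewise[OF continuous_on_product_coordinates[of u]])

text \<open>Each condition equates two expressions built from finitely many values of
  \<open>g\<close>, and evaluation is continuous in the pointwise topology.\<close>

lemma closed_bilinear_symmetric:
  "closed {g :: 'a::real_vector \<Rightarrow> 'a \<Rightarrow> real. bilinear g \<and> (\<forall>u v. g u v = g v u)}"
proof -
  have "{g :: 'a \<Rightarrow> 'a \<Rightarrow> real. bilinear g \<and> (\<forall>u v. g u v = g v u)} =
    {g. \<forall>u v w. g u (v + w) = g u v + g u w} \<inter> {g. \<forall>u r v. g u (r *\<^sub>R v) = r * g u v} \<inter>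
    {g. \<forall>u v w. g (v + w) u = g v u + g w u} \<inter> {g. \<forall>u r v. g (r *\<^sub>R v) u = r * g v u} \<inter>
    {g. \<forall>u v. g u v = g v u}"
    unfolding bilinear_def linear_iff by auto
  also have "closed \<dots>"
    by (intro closed_Int closed_Collect_all closed_Collect_eq continuous_intros continuous_evaluation2)
  finally show ?thesis .
qed

text \<open>The forms whose bounds are dictated by the whole \<open>L\<close>-orbits of the arguments: unlike a bound in
  terms of the norms of \<open>u\<close> and \<open>v\<close>, these conditions are invariant under \<open>L\<close>.\<close>

definition orbit_bounded_forms :: "('e::real_inner \<Rightarrow>\<^sub>L 'e) set \<Rightarrow> ('e \<Rightarrow> 'e \<Rightarrow> real) set" where
  "orbit_bounded_forms L = {g. bilinear g \<and> (\<forall>u v. g u v = g v u) \<and>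
     (\<forall>u c. (\<forall>k\<in>L. c \<le> (norm (k u))\<^sup>2) \<longrightarrow> c \<le> g u u) \<and>
     (\<forall>u v c. (\<forall>k\<in>L. \<forall>l\<in>L. norm (k u) * norm (l v) \<le> c) \<longrightarrow> \<bar>g u v\<bar> \<le> c)}"

lemma orbit_bounded_formsI:
  fixes L :: "('e::real_inner \<Rightarrow>\<^sub>L 'e) set"
  assumes "bilinear g" "\<And>u v. g u v = g v u"
    and "\<And>u c. (\<And>k. k \<in> L \<Longrightarrow> c \<le> (norm (k u))\<^sup>2) \<Longrightarrow> c \<le> g u u"
    and "\<And>u v c. (\<And>k l. k \<in> L \<Longrightarrow> l \<in> L \<Longrightarrow> norm (k u) * norm (l v) \<le> c) \<Longrightarrow> \<bar>g u v\<bar> \<le> c"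
  shows "g \<in> orbit_bounded_forms L"
  unfolding orbit_bounded_forms_def
proof (intro CollectI conjI allI impI)
  show "c \<le> g u u" if "\<forall>k\<in>L. c \<le> (norm (k u))\<^sup>2" for u c
    by (rule assms(3)) (rule bspec[OF that])
  show "\<bar>g u v\<bar> \<le> c" if "\<forall>k\<in>L. \<forall>l\<in>L. norm (k u) * norm (l v) \<le> c" for u v c
    by (rule assms(4)) (rule bspec[OF bspec[OF that]])
qed (fact assms(1) assms(2))+

lemma orbit_bounded_formsD:
  fixes L :: "('e::real_inner \<Rightarrow>\<^sub>L 'e) set"
  assumes "g \<in> orbit_bounded_forms L"
  shows "bilinear g" "g u v = g v u"
    and "(\<And>k. k \<in> L \<Longrightarrow> c \<le> (norm (k u))\<^sup>2) \<Longrightarrow> c \<le> g u u"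
    and "(\<And>k l. k \<in> L \<Longrightarrow> l \<in> L \<Longrightarrow> norm (k u) * norm (l v) \<le> c) \<Longrightarrow> \<bar>g u v\<bar> \<le> c"
proof -
  note g = assms[unfolded orbit_bounded_forms_def mem_Collect_eq]
  show "bilinear g" "g u v = g v u" using g by simp_all
  show "c \<le> g u u" if "\<And>k. k \<in> L \<Longrightarrow> c \<le> (norm (k u))\<^sup>2"
    using g that by simp
  show "\<bar>g u v\<bar> \<le> c" if "\<And>k l. k \<in> L \<Longrightarrow> l \<in> L \<Longrightarrow> norm (k u) * norm (l v) \<le> c"
    using g that by simp
qed

text \<open>Gives nonemptiness of the set in which an invariant form is sought. As the identity is
  in \<open>L\<close>, the bounds apply to \<open>u\<close> and \<open>v\<close> themselves, and
  Cauchy-Schwarz finishes.\<close>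

lemma inner_in_orbit_bounded_forms:
  fixes L :: "('e::real_inner \<Rightarrow>\<^sub>L 'e) set"
  assumes "id_blinfun \<in> L"
  shows "inner \<in> orbit_bounded_forms L"
proof (rule orbit_bounded_formsI)
  fix u v :: 'e and c :: real
  show "bilinear (inner :: 'e \<Rightarrow> 'e \<Rightarrow> real)"
    by (simp add: bilinear_def linear_iff inner_add_left inner_add_right)
  show "u \<bullet> v = v \<bullet> u" by (rule inner_commute)
  show "c \<le> u \<bullet> u" if "\<And>k. k \<in> L \<Longrightarrow> c \<le> (norm (k u))\<^sup>2"
    using that[OF assms] by (simp add: power2_norm_eq_inner)
  show "\<bar>u \<bullet> v\<bar> \<le> c" if "\<And>k l. k \<in> L \<Longrightarrow> l \<in> L \<Longrightarrow> norm (k u) * norm (l v) \<le> c"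
    using Cauchy_Schwarz_ineq2[of u v] that[OF assms assms] by simp
qed

text \<open>Midpoints are the only convex combinations that the strict convexity argument
  uses.\<close>

lemma convex_orbit_bounded_forms:
  fixes L :: "('e::real_inner \<Rightarrow>\<^sub>L 'e) set"
  assumes "g \<in> orbit_bounded_forms L" "h \<in> orbit_bounded_forms L"
  shows "(\<lambda>u v. (g u v + h u v) / 2) \<in> orbit_bounded_forms L"
proof (rule orbit_bounded_formsI)
  note D = orbit_bounded_formsD[OF assms(1)] orbit_bounded_formsD[OF assms(2)]
  show "bilinear (\<lambda>u v. (g u v + h u v) / 2)"
    unfolding bilinear_def linear_iff
    by (simp add: bilinear_ladd[OF D(1)] bilinear_ladd[OF D(5)] bilinear_radd[OF D(1)]
        bilinear_radd[OF D(5)] bilinear_lmul[OF D(1)] bilinear_lmul[OF D(5)] bilinear_rmul[OF D(1)]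
        bilinear_rmul[OF D(5)] add_divide_distrib distrib_left)
  show "(g u v + h u v) / 2 = (g v u + h v u) / 2" for u v
    using D(2,6)[of u v] by simp
  show "c \<le> (g u u + h u u) / 2" if "\<And>k. k \<in> L \<Longrightarrow> c \<le> (norm (k u))\<^sup>2" for c u
  proof -
    show ?thesis using D(3)[OF that] D(7)[OF that] by simp
  qed
  show "\<bar>(g u v + h u v) / 2\<bar> \<le> c"
    if "\<And>k l. k \<in> L \<Longrightarrow> l \<in> L \<Longrightarrow> norm (k u) * norm (l v) \<le> c" for c u v
  proof -
    have "\<bar>g u v\<bar> \<le> c" by (rule D(4), rule that)
    moreover have "\<bar>h u v\<bar> \<le> c" by (rule D(8), rule that)
    ultimately show ?thesis using abs_triangle_ineq[of "g u v" "h u v"] by simp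
  qed
qed

text \<open>Since \<open>L\<close> is closed under composition, the orbit of \<open>k u\<close> lies
  in the orbit of \<open>u\<close>, so bounds valid on the latter hold on the former.\<close>

lemma invariant_orbit_bounded_forms:
  fixes L :: "('e::real_inner \<Rightarrow>\<^sub>L 'e) set"
  assumes "g \<in> orbit_bounded_forms L" "k \<in> L"
    and comp: "\<And>k l. k \<in> L \<Longrightarrow> l \<in> L \<Longrightarrow> k o\<^sub>L l \<in> L"
  shows "(\<lambda>u v. g (k u) (k v)) \<in> orbit_bounded_forms L"
proof (rule orbit_bounded_formsI)
  note D = orbit_bounded_formsD[OF assms(1)]
  show "bilinear (\<lambda>u v. g (k u) (k v))"
    using D(1) unfolding bilinear_def linear_iff
    by (simp add: blinfun.add_right blinfun.scaleR_right)
  show "g (k u) (k v) = g (k v) (k u)" for u v by (rule D(2))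
  show "c \<le> g (k u) (k u)" if "\<And>l. l \<in> L \<Longrightarrow> c \<le> (norm (l u))\<^sup>2" for c u
    using that[OF comp[OF _ assms(2)]] by (intro D(3)) simp
  show "\<bar>g (k u) (k v)\<bar> \<le> c"
    if "\<And>l m. l \<in> L \<Longrightarrow> m \<in> L \<Longrightarrow> norm (l u) * norm (m v) \<le> c" for c u v
    using that[OF comp[OF _ assms(2)] comp[OF _ assms(2)]] by (intro D(4)) simp
qed

text \<open>If \<open>M\<close> bounds the norms of \<open>L\<close>, then orbits grow vectors by at
  most the factor \<open>M\<close>, and the orbit bound becomes a norm bound with constant
  \<open>M * M\<close>, uniform over all the forms.\<close>

lemma orbit_bounded_forms_bound:
  fixes L :: "('e::real_inner \<Rightarrow>\<^sub>L 'e) set"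
  assumes "bounded L"
  shows "\<exists>M. \<forall>g\<in>orbit_bounded_forms L. \<forall>u v. \<bar>g u v\<bar> \<le> M * norm u * norm v"
proof -
  obtain M where M: "M > 0" "\<And>k. k \<in> L \<Longrightarrow> norm k \<le> M"
    using assms bounded_pos by metis
  have le: "norm (k u) \<le> M * norm u" if "k \<in> L" for k and u :: 'e
    by (rule order_trans[OF norm_blinfun mult_right_mono[OF M(2)[OF that] norm_ge_zero]])
  show ?thesis
  proof (intro exI ballI allI)
    show "\<bar>g u v\<bar> \<le> (M * M) * norm u * norm v" if g: "g \<in> orbit_bounded_forms L" for g u v
    proof (rule orbit_bounded_formsD(4)[OF g])
      fix k l assume "k \<in> L" "l \<in> L"
      then have "norm (k u) * norm (l v) \<le> (M * norm u) * (M * norm v)"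
        using M(1) by (intro mult_mono le) simp_all
      then show "norm (k u) * norm (l v) \<le> (M * M) * norm u * norm v"
        by (simp only: mult_ac)
    qed
  qed
qed

lemma orbit_bounded_forms_bounded_bilinear:
  fixes L :: "('e::real_inner \<Rightarrow>\<^sub>L 'e) set"
  assumes "bounded L" "g \<in> orbit_bounded_forms L"
  shows "bounded_bilinear g"
proof -
  obtain M where M: "\<And>u v. \<bar>g u v\<bar> \<le> M * norm u * norm v"
    using orbit_bounded_forms_bound[OF assms(1)] assms(2) by auto
  have "bilinear g" using assms(2) unfolding orbit_bounded_forms_def by simp
  then show ?thesis
    using M
    by unfold_locales
      (auto simp: bilinear_ladd bilinear_radd bilinear_lmul bilinear_rmul mult_ac intro!: exI[of _ M])
qed

text \<open>The orbit of \<open>u\<close> stays away from 0: from \<open>u = k' (k u)\<close> and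
  \<open>norm k' \<le> M\<close> follows \<open>norm (k u) \<ge> norm u / M\<close> for every
  \<open>k\<close> in \<open>L\<close>.\<close>

lemma orbit_bounded_forms_pos:
  fixes L :: "('e::real_inner \<Rightarrow>\<^sub>L 'e) set"
  assumes "bounded L" "g \<in> orbit_bounded_forms L" "u \<noteq> 0"
    and "\<And>k. k \<in> L \<Longrightarrow> \<exists>k'\<in>L. k' o\<^sub>L k = id_blinfun"
  shows "g u u > 0"
proof -
  obtain M where M: "M > 0" "\<And>k. k \<in> L \<Longrightarrow> norm k \<le> M"
    using assms(1) unfolding bounded_pos by auto
  have "(norm u / M)\<^sup>2 \<le> (norm (k u))\<^sup>2" if k: "k \<in> L" for k
  proof -
    obtain k' where k': "k' \<in> L" "k' o\<^sub>L k = id_blinfun" using assms(4)[OF k] by blast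
    have "k' (k u) = u"
      using arg_cong[OF k'(2), of "\<lambda>m. blinfun_apply m u"] by simp
    then have "norm u = norm (k' (k u))" by simp
    also have "\<dots> \<le> M * norm (k u)"
      by (rule order_trans[OF norm_blinfun mult_right_mono[OF M(2)[OF k'(1)] norm_ge_zero]])
    finally show ?thesis using M(1)
      by (intro power_mono) (simp_all add: divide_le_eq mult.commute)
  qed
  then have "(norm u / M)\<^sup>2 \<le> g u u" by (intro orbit_bounded_formsD(3)[OF assms(2)])
  moreover have "(norm u / M)\<^sup>2 > 0" using M(1) assms(3) by simp
  ultimately show ?thesis by linarith
qed

text \<open>The set is closed in the pointwise topology and contained in a compact product of
  intervals.\<close>

lemma compact_orbit_bounded_forms:
  fixes L :: "('e::real_inner \<Rightarrow>\<^sub>L 'e) set"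
  assumes "bounded L"
  shows "compact (orbit_bounded_forms L)"
proof -
  obtain M where M: "\<And>g u v. g \<in> orbit_bounded_forms L \<Longrightarrow> \<bar>g u v\<bar> \<le> M * norm u * norm v"
    using orbit_bounded_forms_bound[OF assms] by auto
  \<comment> \<open>\<open>P\<close> and \<open>Q\<close> stand for the orbit conditions on
    \<open>u\<close>, \<open>v\<close> and \<open>c\<close>. They do not involve \<open>g\<close>,
    so each implication is a closed condition on a single value of \<open>g\<close>.\<close>
  have "closed {g :: 'e \<Rightarrow> 'e \<Rightarrow> real. \<forall>u c. P u c \<longrightarrow> c \<le> g u u}"
    "closed {g :: 'e \<Rightarrow> 'e \<Rightarrow> real. \<forall>u v c. Q u v c \<longrightarrow> \<bar>g u v\<bar> \<le> c}" for P Q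
    by (intro closed_Collect_all closed_Collect_imp closed_Collect_le open_Collect_const
        continuous_on_const continuous_on_rabs continuous_evaluation2)+
  then have "closed (orbit_bounded_forms L)"
    unfolding orbit_bounded_forms_def conj_assoc[symmetric]
    by (intro closed_Collect_conj[of "\<lambda>g. (bilinear g \<and> _ g) \<and> _ g"]
      closed_Collect_conj[of "\<lambda>g. bilinear g \<and> _ g"] closed_bilinear_symmetric)
  moreover have "orbit_bounded_forms L \<subseteq> {g. \<forall>u v. \<bar>g u v\<bar> \<le> M * norm u * norm v}"
    using M by blast
  ultimately show ?thesis
    using compact_Int_closed[OF compact_pointwise_bounded[of "\<lambda>u v. M * norm u * norm v"],
        of "orbit_bounded_forms L"]
    by (simp add: inf.absorb2)
qed

text \<open>A compact group acting linearly fixes a positive definite form. No Haar measure is needed: among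
  the forms in a convex compact invariant set, the one minimising the largest Hilbert--Schmidt norm
  (with respect to a spanning set) on its orbit is unique by strict convexity, hence fixed.\<close>

lemma compact_group_invariant_inner_product:
  fixes L :: "('e::real_inner \<Rightarrow>\<^sub>L 'e) set"
  assumes "finite (B :: 'e set)" "span B = UNIV" "compact L" "id_blinfun \<in> L"
    and comp: "\<And>k l. k \<in> L \<Longrightarrow> l \<in> L \<Longrightarrow> k o\<^sub>L l \<in> L"
    and inv: "\<And>k. k \<in> L \<Longrightarrow> \<exists>k'\<in>L. k o\<^sub>L k' = id_blinfun \<and> k' o\<^sub>L k = id_blinfun"
  shows "\<exists>q :: 'e \<Rightarrow> 'e \<Rightarrow> real. bounded_bilinear q \<and> (\<forall>u v. q u v = q v u) \<and>
    (\<forall>u. u \<noteq> 0 \<longrightarrow> q u u > 0) \<and> (\<forall>k\<in>L. \<forall>u v. q (k u) (k v) = q u v)"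
proof -
  let ?C = "orbit_bounded_forms L"
  define act where "act k g u v = g (blinfun_apply k u) (blinfun_apply k v)"
    for k :: "'e \<Rightarrow>\<^sub>L 'e" and g :: "'e \<Rightarrow> 'e \<Rightarrow> real" and u v
  define S where "S g = (\<Sum>b\<in>B. \<Sum>c\<in>B. (g b c)\<^sup>2)" for g :: "'e \<Rightarrow> 'e \<Rightarrow> real"
  \<comment> \<open>\<open>Cr r\<close> is the sublevel set at \<open>r\<close> of the supremum of
    \<open>S\<close> over the orbit, and \<open>R\<close> consists of the levels that are reached
    within \<open>?C\<close>. A form in \<open>?C\<close> lying in \<open>Cr r\<close> for all
    \<open>r\<close> in \<open>R\<close> therefore minimises this supremum.\<close>
  define Cr where "Cr r = {g. \<forall>k\<in>L. S (act k g) \<le> r}" for r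
  define R where "R = {r. ?C \<inter> Cr r \<noteq> {}}"
  have bounded: "bounded L" using assms(3) by (rule compact_imp_bounded)
  have invariant: "act k g \<in> ?C" if "g \<in> ?C" "k \<in> L" for g k
    unfolding act_def by (rule invariant_orbit_bounded_forms[OF that]) (rule comp)
  have "closed (Cr r)" for r
    unfolding Cr_def S_def act_def Ball_def
    by (intro closed_Collect_all closed_Collect_imp closed_Collect_le open_Collect_const
        continuous_intros continuous_evaluation2)
  \<comment> \<open>The sublevel sets are nested, so a finite intersection contains the one of least
    level. This is the finite intersection property for the compact set \<open>?C\<close>.\<close>
  moreover have "?C \<inter> (\<Inter>r\<in>I. Cr r) \<noteq> {}" if "finite I" "I \<subseteq> R" for I
  proof (cases "I = {}")
    case True
    then show ?thesis using inner_in_orbit_bounded_forms[OF assms(4)] by auto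
  next
    case False
    then have "Cr (Min I) \<subseteq> (\<Inter>r\<in>I. Cr r)"
      unfolding Cr_def using Min_le[OF that(1)] by fastforce
    moreover have "?C \<inter> Cr (Min I) \<noteq> {}"
      using Min_in[OF that(1) False] that(2) unfolding R_def by blast
    ultimately show ?thesis by blast
  qed
  ultimately have "?C \<inter> (\<Inter>r\<in>R. Cr r) \<noteq> {}"
    by (rule compact_imp_fip_image[OF compact_orbit_bounded_forms[OF bounded]])
  then obtain q where q: "q \<in> ?C" "\<And>r. r \<in> R \<Longrightarrow> q \<in> Cr r" by auto
  have unique: "h = q" if h: "h \<in> ?C" "\<And>r. r \<in> R \<Longrightarrow> h \<in> Cr r" for h
  proof -
    define m where "m u v = (q u v + h u v) / 2" for u v
    have m: "m \<in> ?C" unfolding m_def by (rule convex_orbit_bounded_forms[OF q(1) h(1)])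
    \<comment> \<open>Compactness of \<open>L\<close> makes the orbit supremum of the midpoint
      \<open>m\<close> a value attained at some \<open>k\<close>. This value is a level in
      \<open>R\<close>, so it also bounds \<open>S\<close> at \<open>act k q\<close> and
      \<open>act k h\<close>.\<close>
    have "continuous_on L (\<lambda>k. S (act k m))"
      unfolding S_def act_def
      by (intro continuous_intros bounded_bilinear.continuous_on
          [OF orbit_bounded_forms_bounded_bilinear[OF bounded m]])
    then obtain k where k: "k \<in> L" "\<And>l. l \<in> L \<Longrightarrow> S (act l m) \<le> S (act k m)"
      using continuous_attains_sup[OF assms(3)] assms(4) by blast
    then have "S (act k m) \<in> R" using m unfolding R_def Cr_def by blast
    then have le: "S (act k q) \<le> S (act k m)" "S (act k h) \<le> S (act k m)"
      using q(2) h(2) k(1) unfolding Cr_def by auto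
    define d where "d u v = q u v - h u v" for u v
    \<comment> \<open>The parallelogram law for \<open>S\<close>. With the two bounds it leaves no
      room for the difference \<open>d\<close>.\<close>
    have "2 * S (act k q) + 2 * S (act k h) = 4 * S (act k m) + S (act k d)"
      unfolding S_def act_def m_def d_def sum_distrib_left sum.distrib[symmetric]
      by (intro sum.cong refl) (simp add: power2_eq_square field_simps)
    then have "S (act k d) \<le> 0" using le by linarith
    then have zero: "d (k b) (k c) = 0" if "b \<in> B" "c \<in> B" for b c
    proof -
      have "(d (k b) (k c))\<^sup>2 \<le> (\<Sum>c\<in>B. (d (k b) (k c))\<^sup>2)"
        using member_le_sum[of c B "\<lambda>c. (d (k b) (k c))\<^sup>2"] that assms(1) by simp
      also have "\<dots> \<le> S (act k d)"
        using member_le_sum[of b B "\<lambda>b. \<Sum>c\<in>B. (d (k b) (k c))\<^sup>2"] that assms(1)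
        unfolding S_def act_def by (simp add: sum_nonneg)
      also note \<open>S (act k d) \<le> 0\<close>
      finally show ?thesis by simp
    qed
    \<comment> \<open>\<open>zero\<close> makes the pullbacks by \<open>k\<close> agree on a
      spanning set, hence everywhere. Substituting \<open>k' u\<close> and \<open>k' v\<close> then
      removes \<open>k\<close>.\<close>
    obtain k' where k': "k' \<in> L" "k o\<^sub>L k' = id_blinfun" using inv[OF k(1)] by blast
    have "bilinear (act k q)" "bilinear (act k h)"
      using invariant[OF q(1) k(1)] invariant[OF h(1) k(1)] by (simp_all add: orbit_bounded_formsD(1))
    then have "act k q u v = act k h u v" for u v
      by (rule bilinear_eq_on_spanning[OF _ _ assms(2)]) (use zero in \<open>simp add: act_def d_def\<close>)
    moreover have "k (k' u) = u" for u
      using arg_cong[OF k'(2), of "\<lambda>m. blinfun_apply m u"] by simp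
    ultimately have "q u v = h u v" for u v
      using \<open>\<And>u v. act k q u v = act k h u v\<close>[of "k' u" "k' v"] by (simp add: act_def)
    then show "h = q" by (intro ext) simp
  qed
  have fixed: "act k q = q" if k: "k \<in> L" for k
  proof (rule unique)
    show "act k q \<in> ?C" by (rule invariant[OF q(1) k])
    show "act k q \<in> Cr r" if "r \<in> R" for r
    proof -
      \<comment> \<open>Pullback reverses composition, so the orbit of \<open>act k q\<close> is
        contained in that of \<open>q\<close>, and \<open>act k q\<close> is again a
        minimiser.\<close>
      have "act l (act k q) = act (k o\<^sub>L l) q" for l
        unfolding act_def by simp
      then show ?thesis using q(2)[OF that] comp[OF k] unfolding Cr_def by simp
    qed
  qed
  show ?thesis
  proof (intro exI[of _ q] conjI allI impI ballI)
    show "bounded_bilinear q" by (rule orbit_bounded_forms_bounded_bilinear[OF bounded q(1)])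
    show "q u v = q v u" for u v by (rule orbit_bounded_formsD(2)[OF q(1)])
    show "q u u > 0" if "u \<noteq> 0" for u
      by (rule orbit_bounded_forms_pos[OF bounded q(1) that]) (use inv in blast)
    show "q (k u) (k v) = q u v" if "k \<in> L" for k u v
      using fun_cong[OF fun_cong[OF fixed[OF that]], of u v] unfolding act_def .
  qed
qed

subsection \<open>Derivatives in charts\<close>

lemma chart_at_in:
  assumes "smooth_atlas A"
  shows "chart_at A p \<in> A" "p \<in> fst (chart_at A p)"
proof -
  have "\<exists>\<kappa>. \<kappa> \<in> A \<and> p \<in> fst \<kappa>" using assms unfolding smooth_atlas_def by blast
  then have "chart_at A p \<in> A \<and> p \<in> fst (chart_at A p)" unfolding chart_at_def by (rule someI_ex)
  then show "chart_at A p \<in> A" "p \<in> fst (chart_at A p)" by blast+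
qed

lemma chart_homeomorphism:
  "smooth_atlas A \<Longrightarrow> \<kappa> \<in> A \<Longrightarrow> homeomorphism (fst \<kappa>) (snd \<kappa> ` fst \<kappa>) (snd \<kappa>) (chart_inv \<kappa>)"
  unfolding smooth_atlas_def by blast

lemma chart_inv_apply:
  "smooth_atlas A \<Longrightarrow> \<kappa> \<in> A \<Longrightarrow> p \<in> fst \<kappa> \<Longrightarrow> chart_inv \<kappa> (snd \<kappa> p) = p"
  by (rule homeomorphism_apply1[OF chart_homeomorphism])

lemma chart_apply_inv:
  assumes "x \<in> snd \<kappa> ` fst \<kappa>"
  shows "chart_inv \<kappa> x \<in> fst \<kappa>" "snd \<kappa> (chart_inv \<kappa> x) = x"
  using assms unfolding chart_inv_def by (rule inv_into_into, rule f_inv_into_f)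

lemma open_chart_image:
  assumes "smooth_atlas A" "\<kappa> \<in> A" "open U"
  shows "open (snd \<kappa> ` (fst \<kappa> \<inter> U))"
proof -
  have "open (snd \<kappa> ` fst \<kappa>)" using assms unfolding smooth_atlas_def by blast
  moreover have "openin (top_of_set (snd \<kappa> ` fst \<kappa>)) (snd \<kappa> ` (fst \<kappa> \<inter> U))"
    by (rule homeomorphism_imp_open_map[OF chart_homeomorphism[OF assms(1,2)]])
      (use assms(3) in \<open>auto simp: openin_open\<close>)
  ultimately show ?thesis using openin_open_eq by blast
qed

lemma open_chart_range: "smooth_atlas A \<Longrightarrow> \<kappa> \<in> A \<Longrightarrow> open (snd \<kappa> ` fst \<kappa>)"
  using open_chart_image[of A \<kappa> UNIV] by simp

lemma local_rep_chart:
  "smooth_atlas A \<Longrightarrow> \<kappa> \<in> A \<Longrightarrow> p \<in> fst \<kappa> \<Longrightarrow> local_rep \<kappa> \<mu> f (snd \<kappa> p) = snd \<mu> (f p)"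
  unfolding local_rep_def by (simp add: chart_inv_apply)

lemma open_vimage_continuous: "continuous_on UNIV f \<Longrightarrow> open U \<Longrightarrow> open (f -` U)"
  using continuous_on_open_vimage[OF open_UNIV] by (metis inf_top_right)

lemma open_local_rep_domain:
  assumes "smooth_atlas A" "smooth_atlas B" "smooth_map A B f" "\<kappa> \<in> A" "\<mu> \<in> B"
  shows "open (snd \<kappa> ` (fst \<kappa> \<inter> f -` fst \<mu>))"
proof (rule open_chart_image[OF assms(1,4)])
  have "open (fst \<mu>)" using assms(2,5) unfolding smooth_atlas_def by blast
  then show "open (f -` fst \<mu>)"
    using assms(3) unfolding smooth_map_def by (intro open_vimage_continuous) blast+
qed

lemma local_rep_differentiable:
  assumes "smooth_map A B f" "\<kappa> \<in> A" "\<mu> \<in> B" "p \<in> fst \<kappa>" "f p \<in> fst \<mu>"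
  shows "local_rep \<kappa> \<mu> f differentiable (at (snd \<kappa> p))"
  using assms unfolding smooth_map_def by (intro smooth_on_imp_differentiable) auto

text \<open>Allowing arbitrary charts on both sides covers \<open>change_chart\<close> and
  \<open>tangent_map\<close> at once, so that one chain rule serves both.\<close>

definition chart_deriv ::
    "('g, 'e::real_normed_vector) chart \<Rightarrow> ('h, 'f::real_normed_vector) chart \<Rightarrow> ('g \<Rightarrow> 'h) \<Rightarrow> 'g \<Rightarrow> 'e \<Rightarrow> 'f"
  where "chart_deriv \<kappa> \<mu> f p = frechet_derivative (local_rep \<kappa> \<mu> f) (at (snd \<kappa> p))"

lemma change_chart_eq: "change_chart \<kappa> \<mu> p = chart_deriv \<kappa> \<mu> id p"
  unfolding change_chart_def chart_deriv_def ..

lemma tangent_map_eq: "tangent_map A B f p = chart_deriv (chart_at A p) (chart_at B (f p)) f p"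
  unfolding tangent_map_def chart_deriv_def ..

text \<open>The chain rule. The composite of the local representatives agrees with the
  representative of the composite where \<open>h\<close> lands in the domain of
  \<open>\<mu>\<close>. This set is open in coordinates, which suffices for derivatives.\<close>

lemma chart_deriv_compose:
  assumes "smooth_atlas A" "smooth_atlas B" "smooth_map A B h" "smooth_map B C f"
    and "\<kappa> \<in> A" "\<mu> \<in> B" "\<nu> \<in> C" "p \<in> fst \<kappa>" "h p \<in> fst \<mu>" "f (h p) \<in> fst \<nu>"
  shows "chart_deriv \<kappa> \<nu> (f \<circ> h) p = chart_deriv \<mu> \<nu> f (h p) \<circ> chart_deriv \<kappa> \<mu> h p"
proof -
  let ?U = "snd \<kappa> ` (fst \<kappa> \<inter> h -` fst \<mu>)"
  have h: "(local_rep \<kappa> \<mu> h has_derivative chart_deriv \<kappa> \<mu> h p) (at (snd \<kappa> p))"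
    using local_rep_differentiable[OF assms(3,5,6,8,9)]
    unfolding chart_deriv_def frechet_derivative_works .
  have "(local_rep \<mu> \<nu> f has_derivative chart_deriv \<mu> \<nu> f (h p)) (at (snd \<mu> (h p)))"
    using local_rep_differentiable[OF assms(4,6,7,9,10)]
    unfolding chart_deriv_def frechet_derivative_works .
  then have "(local_rep \<mu> \<nu> f \<circ> local_rep \<kappa> \<mu> h has_derivative
      chart_deriv \<mu> \<nu> f (h p) \<circ> chart_deriv \<kappa> \<mu> h p) (at (snd \<kappa> p))"
    by (intro diff_chain_at[OF h]) (simp add: local_rep_chart[OF assms(1,5,8)])
  moreover have "(local_rep \<mu> \<nu> f \<circ> local_rep \<kappa> \<mu> h) x = local_rep \<kappa> \<nu> (f \<circ> h) x" if "x \<in> ?U" for x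
    using that chart_inv_apply[OF assms(2,6)] chart_inv_apply[OF assms(1,5)]
    by (auto simp: local_rep_def)
  ultimately have "(local_rep \<kappa> \<nu> (f \<circ> h) has_derivative
      chart_deriv \<mu> \<nu> f (h p) \<circ> chart_deriv \<kappa> \<mu> h p) (at (snd \<kappa> p))"
    using has_derivative_transform_within_open[OF _ open_local_rep_domain[OF assms(1-3,5,6)]]
      assms(8,9) by blast
  then show ?thesis
    unfolding chart_deriv_def[of \<kappa> \<nu>] by (rule frechet_derivative_at[symmetric])
qed

lemma chart_deriv_id:
  assumes "smooth_atlas A" "\<kappa> \<in> A" "p \<in> fst \<kappa>"
  shows "chart_deriv \<kappa> \<kappa> id p = id"
proof -
  have "((\<lambda>x. x) has_derivative id) (at (snd \<kappa> p))" unfolding id_def by (rule has_derivative_ident)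
  then have "(local_rep \<kappa> \<kappa> id has_derivative id) (at (snd \<kappa> p))"
    by (rule has_derivative_transform_within_open[OF _ open_chart_range[OF assms(1,2)]])
      (use assms in \<open>auto simp: local_rep_def chart_inv_apply\<close>)
  then show ?thesis unfolding chart_deriv_def by (rule frechet_derivative_at[symmetric])
qed

lemma smooth_map_id: "smooth_atlas A \<Longrightarrow> smooth_map A A id"
  unfolding smooth_map_def smooth_atlas_def local_rep_def by (auto simp: continuous_on_id)

lemma tangent_map_compose:
  assumes "smooth_atlas A" "smooth_atlas B" "smooth_atlas C" "smooth_map A B h" "smooth_map B C f"
  shows "tangent_map A C (f \<circ> h) p = tangent_map B C f (h p) \<circ> tangent_map A B h p"
  unfolding tangent_map_eq o_apply[of f h p]
  by (rule chart_deriv_compose[OF assms(1,2,4,5)]; intro chart_at_in assms)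

lemma tangent_map_id: "smooth_atlas A \<Longrightarrow> tangent_map A A id p = id"
  unfolding tangent_map_eq by (simp add: chart_deriv_id chart_at_in)

lemma bounded_linear_tangent_map:
  assumes "smooth_atlas A" "smooth_atlas B" "smooth_map A B f"
  shows "bounded_linear (tangent_map A B f p)"
  unfolding tangent_map_def
  using local_rep_differentiable[OF assms(3) chart_at_in(1)[OF assms(1)] chart_at_in(1)[OF assms(2)]
      chart_at_in(2)[OF assms(1)] chart_at_in(2)[OF assms(2)]]
  unfolding frechet_derivative_works by (rule has_derivative_bounded_linear)

lemma smooth_atlas_span_Times:
  fixes A :: "('g::{t2_space,second_countable_topology}, 'e::real_inner) chart set"
  assumes "smooth_atlas A"
  obtains E :: "('e \<times> 'e) set" where "finite E" "span E = UNIV"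
proof -
  obtain B :: "'e set" where "finite B" "span B = UNIV" using assms unfolding smooth_atlas_def by blast
  then show thesis using span_Times_UNIV[of B B] that by blast
qed

text \<open>Here the first derivative is 1 and the second is 0, so the convexity expression
  collapses to the constant \<open>b\<close>.\<close>

lemma alpha_beta_function_shift:
  assumes "b > 0"
  shows "alpha_beta_function b (\<lambda>s. b + s)"
proof -
  have "deriv (\<lambda>s. b + s) = (\<lambda>s. 1)" by (intro ext DERIV_imp_deriv) (auto intro!: derivative_eq_intros)
  then show ?thesis
    using assms unfolding alpha_beta_function_def
    by (auto intro!: smooth_on_add smooth_on_const smooth_on_ident)
qed

text \<open>The differential of the inverse map is a left inverse of the differential.\<close>

lemma tangent_map_diffeomorphism_eq_0:
  assumes "smooth_atlas A" "diffeomorphism A \<psi>" "tangent_map A A \<psi> p u = 0"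
  shows "u = 0"
proof -
  let ?\<theta> = "inv_into UNIV \<psi>"
  have smooth: "smooth_map A A \<psi>" "smooth_map A A ?\<theta>" and "?\<theta> \<circ> \<psi> = id"
    using assms(2) unfolding diffeomorphism_def by (auto simp: bij_def)
  then have "tangent_map A A ?\<theta> (\<psi> p) (tangent_map A A \<psi> p u) = u"
    using tangent_map_compose[OF assms(1,1,1) smooth, of p] by (metis tangent_map_id assms(1) o_apply id_apply)
  then show ?thesis
    using assms(3) linear_0[OF bounded_linear.linear[OF bounded_linear_tangent_map[OF assms(1,1) smooth(2)]]]
    by metis
qed

subsection \<open>Left invariant structures on Lie groups\<close>

locale lie_group_atlas =
  fixes G :: "('g::{t2_space,second_countable_topology}, 'm) monoid_scheme" (structure)
    and A :: "('g, 'e::real_inner) chart set"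
  assumes lie_group: "lie_group G A"
begin

lemma atlas: "smooth_atlas A" and carrier [simp]: "carrier G = UNIV"
  and smooth_mult: "smooth_map (prod_atlas A A) A (\<lambda>(x, y). x \<otimes> y)"
  and smooth_inv: "smooth_map A A (\<lambda>x. inv x)"
  using lie_group unfolding lie_group_def by blast+

sublocale group G
  using lie_group unfolding lie_group_def by blast

lemma continuous_mult: "continuous_on UNIV (\<lambda>(x, y). x \<otimes> y)"
  using smooth_mult unfolding smooth_map_def by blast

section \<open>The group multiplication in coordinates\<close>

definition mult_domain where
  "mult_domain \<mu> \<kappa> \<nu> =
     {(a, b) \<in> (snd \<mu> ` fst \<mu>) \<times> (snd \<kappa> ` fst \<kappa>). chart_inv \<mu> a \<otimes> chart_inv \<kappa> b \<in> fst \<nu>}"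

definition mult_rep where
  "mult_rep \<mu> \<kappa> \<nu> = (\<lambda>(a, b). snd \<nu> (chart_inv \<mu> a \<otimes> chart_inv \<kappa> b))"

lemma open_mult_domain:
  assumes "\<mu> \<in> A" "\<kappa> \<in> A" "\<nu> \<in> A"
  shows "open (mult_domain \<mu> \<kappa> \<nu>)"
proof -
  let ?D = "(snd \<mu> ` fst \<mu>) \<times> (snd \<kappa> ` fst \<kappa>)"
  let ?f = "\<lambda>z. (\<lambda>(x, y). x \<otimes> y) (chart_inv \<mu> (fst z), chart_inv \<kappa> (snd z))"
  have inv: "continuous_on (snd \<rho> ` fst \<rho>) (chart_inv \<rho>)" if "\<rho> \<in> A" for \<rho>
    by (rule homeomorphism_cont2[OF chart_homeomorphism[OF atlas that]])
  have "continuous_on ?D (\<lambda>z. (chart_inv \<mu> (fst z), chart_inv \<kappa> (snd z)))"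
    by (intro continuous_on_Pair continuous_on_compose2[OF inv] continuous_intros assms) auto
  then have "continuous_on ?D ?f"
    by (rule continuous_on_compose2[OF continuous_mult]) simp
  moreover have "open ?D" by (intro open_Times open_chart_range[OF atlas] assms)
  moreover have "open (fst \<nu>)" using atlas assms(3) unfolding smooth_atlas_def by blast
  ultimately have "open (?D \<inter> ?f -` fst \<nu>)" by (rule continuous_open_preimage)
  moreover have "?D \<inter> ?f -` fst \<nu> = mult_domain \<mu> \<kappa> \<nu>"
    unfolding mult_domain_def by auto
  ultimately show ?thesis by simp
qed

text \<open>Smoothness of the multiplication is given in product charts, whose
  \<open>chart_inv\<close> is an \<open>inv_into\<close> on a product. Injectivity of both charts
  identifies it with the pair of the two inverses.\<close>

lemma smooth_mult_rep:
  assumes "\<mu> \<in> A" "\<kappa> \<in> A" "\<nu> \<in> A"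
  shows "smooth_on (mult_domain \<mu> \<kappa> \<nu>) (mult_rep \<mu> \<kappa> \<nu>)"
proof -
  let ?\<pi> = "(fst \<mu> \<times> fst \<kappa>, map_prod (snd \<mu>) (snd \<kappa>))"
  have "?\<pi> \<in> prod_atlas A A" using assms unfolding prod_atlas_def by blast
  then have smooth: "smooth_on (snd ?\<pi> ` (fst ?\<pi> \<inter> (\<lambda>(x, y). x \<otimes> y) -` fst \<nu>))
      (local_rep ?\<pi> \<nu> (\<lambda>(x, y). x \<otimes> y))"
    using smooth_mult assms(3) unfolding smooth_map_def by blast
  have "inj_on (snd \<rho>) (fst \<rho>)" if "\<rho> \<in> A" for \<rho>
    using chart_inv_apply[OF atlas that] by (rule inj_on_inverseI)
  then have inj: "inj_on (map_prod (snd \<mu>) (snd \<kappa>)) (fst \<mu> \<times> fst \<kappa>)"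
    using assms by (intro map_prod_inj_on)
  have inv: "chart_inv ?\<pi> (snd \<mu> p, snd \<kappa> r) = (p, r)" if "p \<in> fst \<mu>" "r \<in> fst \<kappa>" for p r
    using inv_into_f_f[OF inj, of "(p, r)"] that unfolding chart_inv_def by simp
  have dom: "mult_domain \<mu> \<kappa> \<nu> = snd ?\<pi> ` (fst ?\<pi> \<inter> (\<lambda>(x, y). x \<otimes> y) -` fst \<nu>)"
  proof (intro equalityI subsetI)
    fix z assume "z \<in> mult_domain \<mu> \<kappa> \<nu>"
    then obtain p r where "p \<in> fst \<mu>" "r \<in> fst \<kappa>" "z = (snd \<mu> p, snd \<kappa> r)" "p \<otimes> r \<in> fst \<nu>"
      using chart_inv_apply[OF atlas assms(1)] chart_inv_apply[OF atlas assms(2)]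
      unfolding mult_domain_def by auto
    then show "z \<in> snd ?\<pi> ` (fst ?\<pi> \<inter> (\<lambda>(x, y). x \<otimes> y) -` fst \<nu>)"
      by (intro image_eqI[of _ _ "(p, r)"]) simp_all
  next
    fix z assume "z \<in> snd ?\<pi> ` (fst ?\<pi> \<inter> (\<lambda>(x, y). x \<otimes> y) -` fst \<nu>)"
    then show "z \<in> mult_domain \<mu> \<kappa> \<nu>"
      using chart_inv_apply[OF atlas assms(1)] chart_inv_apply[OF atlas assms(2)]
      unfolding mult_domain_def by auto
  qed
  show ?thesis
  proof (rule smooth_on_cong[OF open_mult_domain[OF assms]])
    show "smooth_on (mult_domain \<mu> \<kappa> \<nu>) (local_rep ?\<pi> \<nu> (\<lambda>(x, y). x \<otimes> y))"
      unfolding dom by (rule smooth)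
    show "local_rep ?\<pi> \<nu> (\<lambda>(x, y). x \<otimes> y) z = mult_rep \<mu> \<kappa> \<nu> z" if "z \<in> mult_domain \<mu> \<kappa> \<nu>" for z
      using that chart_inv_apply[OF atlas assms(1)] chart_inv_apply[OF atlas assms(2)]
      unfolding mult_domain_def mult_rep_def local_rep_def by (auto simp: inv)
  qed
qed

text \<open>In coordinates the translation is the multiplication with its first argument frozen at
  the coordinates of \<open>h\<close>.\<close>

lemma smooth_left_translation: "smooth_map A A (left_translation G h)"
  unfolding smooth_map_def
proof (intro conjI ballI)
  let ?\<mu> = "chart_at A h"
  have "continuous_on UNIV (\<lambda>x. (\<lambda>(x, y). x \<otimes> y) (h, x))"
    by (intro continuous_on_compose2[OF continuous_mult] continuous_intros) auto
  then show cont: "continuous_on UNIV (left_translation G h)"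
    unfolding left_translation_def by simp
  fix \<kappa> \<nu> assume \<kappa>: "\<kappa> \<in> A" and \<nu>: "\<nu> \<in> A"
  let ?S = "snd \<kappa> ` (fst \<kappa> \<inter> left_translation G h -` fst \<nu>)"
  obtain E :: "('e \<times> 'e) set" where E: "finite E" "span E = UNIV"
    using smooth_atlas_span_Times[OF atlas] .
  have "open (fst \<nu>)" using atlas \<nu> unfolding smooth_atlas_def by blast
  then have open_S: "open ?S"
    by (intro open_chart_image[OF atlas \<kappa>] open_vimage_continuous cont)
  have h: "chart_inv ?\<mu> (snd ?\<mu> h) = h"
    by (rule chart_inv_apply[OF atlas chart_at_in[OF atlas]])
  show "smooth_on ?S (local_rep \<kappa> \<nu> (left_translation G h))"
  proof (rule smooth_on_cong[OF open_S])
    show "smooth_on ?S (\<lambda>x. mult_rep ?\<mu> \<kappa> \<nu> (snd ?\<mu> h, x))"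
    proof (rule smooth_on_compose[OF E open_S _ smooth_mult_rep[OF chart_at_in(1)[OF atlas] \<kappa> \<nu>]])
      show "Pair (snd ?\<mu> h) ` ?S \<subseteq> mult_domain ?\<mu> \<kappa> \<nu>"
        using chart_at_in(2)[OF atlas, of h] chart_inv_apply[OF atlas \<kappa>]
        unfolding mult_domain_def by (auto simp: h left_translation_def)
    qed (intro smooth_on_Pair open_S smooth_on_const smooth_on_ident)
  qed (simp add: mult_rep_def local_rep_def left_translation_def h)
qed

text \<open>The source of left invariance: translating by \<open>h\<close> and then moving
  \<open>h \<otimes> p\<close> to the identity is the same as moving \<open>p\<close> to the
  identity directly.\<close>

lemma tangent_left_translation_compose:
  "tangent_map A A (left_translation G (inv (h \<otimes> p))) (h \<otimes> p) \<circ> tangent_map A A (left_translation G h) p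
    = tangent_map A A (left_translation G (inv p)) p"
proof -
  have "left_translation G (inv (h \<otimes> p)) \<circ> left_translation G h = left_translation G (inv p)"
  proof
    fix x
    have "inv h \<otimes> (h \<otimes> x) = x"
      by (simp flip: m_assoc)
    then show "(left_translation G (inv (h \<otimes> p)) \<circ> left_translation G h) x = left_translation G (inv p) x"
      by (simp add: left_translation_def inv_mult_group m_assoc)
  qed
  then show ?thesis
    using tangent_map_compose[OF atlas atlas atlas smooth_left_translation smooth_left_translation,
        of "inv (h \<otimes> p)" h p]
    by (simp add: left_translation_def[of G h])
qed

lemma tangent_left_translation_inj:
  assumes "tangent_map A A (left_translation G h) p u = 0"
  shows "u = 0"
proof -
  have "left_translation G (inv h) \<circ> left_translation G h = id"
    by (auto simp: left_translation_def simp flip: m_assoc)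
  then have "tangent_map A A (left_translation G (inv h)) (left_translation G h p)
      (tangent_map A A (left_translation G h) p u) = u"
    using tangent_map_compose[OF atlas atlas atlas smooth_left_translation smooth_left_translation,
        of "inv h" h p] by (metis atlas tangent_map_id o_apply id_apply)
  then show ?thesis
    using assms bounded_linear_tangent_map[OF atlas atlas smooth_left_translation]
    by (metis bounded_linear.linear linear_0)
qed

text \<open>The translating element varies together with the base point, so smoothness of each
  single translation is not enough. The vector is instead a partial derivative of the multiplication
  in its second argument, taken at \<open>(inv p, p)\<close>, and this pair depends smoothly on
  \<open>p\<close>.\<close>

lemma smooth_left_trivialisation:
  assumes "\<kappa> \<in> A"
  shows "smooth_on (snd \<kappa> ` fst \<kappa>) (\<lambda>x. let p = chart_inv \<kappa> x in
    tangent_map A A (left_translation G (inv p)) p (change_chart \<kappa> (chart_at A p) p u))"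
    (is "smooth_on _ ?\<Phi>")
proof (rule smooth_on_local)
  fix x\<^sub>0 assume x0: "x\<^sub>0 \<in> snd \<kappa> ` fst \<kappa>"
  \<comment> \<open>The charts \<open>\<mu>\<close>, \<open>\<kappa>\<close> and
    \<open>\<epsilon>\<close> are those of the two factors and of their product
    \<open>inv p \<otimes> p\<close>, the identity. On \<open>V\<close> the inverse stays within the
    chart \<open>\<mu>\<close>.\<close>
  define \<mu> where "\<mu> = chart_at A (inv (chart_inv \<kappa> x\<^sub>0))"
  define \<epsilon> where "\<epsilon> = chart_at A \<one>"
  define V where "V = snd \<kappa> ` (fst \<kappa> \<inter> (\<lambda>p. inv p) -` fst \<mu>)"
  define \<iota> where "\<iota> = local_rep \<kappa> \<mu> (\<lambda>p. inv p)"
  have \<mu>: "\<mu> \<in> A" and \<epsilon>: "\<epsilon> \<in> A" "\<one> \<in> fst \<epsilon>"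
    unfolding \<mu>_def \<epsilon>_def by (intro chart_at_in atlas)+
  obtain E :: "('e \<times> 'e) set" where E: "finite E" "span E = UNIV"
    using smooth_atlas_span_Times[OF atlas] .
  have open_V: "open V"
    unfolding V_def by (rule open_local_rep_domain[OF atlas atlas smooth_inv assms \<mu>])
  have V: "chart_inv \<kappa> x \<in> fst \<kappa>" "snd \<kappa> (chart_inv \<kappa> x) = x" "inv (chart_inv \<kappa> x) \<in> fst \<mu>"
    "chart_inv \<mu> (\<iota> x) = inv (chart_inv \<kappa> x)" "\<iota> x \<in> snd \<mu> ` fst \<mu>" if "x \<in> V" for x
    using that chart_inv_apply[OF atlas assms] chart_inv_apply[OF atlas \<mu>]
    unfolding V_def \<iota>_def by (auto simp: local_rep_def)
  have mem: "(\<iota> x, x) \<in> mult_domain \<mu> \<kappa> \<epsilon>" if "x \<in> V" for x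
    using V[OF that] \<epsilon>(2) imageI[OF V(1)[OF that], of "snd \<kappa>"] unfolding mult_domain_def by simp
  have "smooth_on V (\<lambda>x. frechet_derivative (mult_rep \<mu> \<kappa> \<epsilon>) (at (\<iota> x, x)) (0, u))"
  proof (rule smooth_on_compose[OF E open_V _ smooth_on_frechet_derivative
        [OF smooth_mult_rep[OF \<mu> assms \<epsilon>(1)]]])
    show "(\<lambda>x. (\<iota> x, x)) ` V \<subseteq> mult_domain \<mu> \<kappa> \<epsilon>" using mem by blast
    have "smooth_on V \<iota>"
      using smooth_inv assms \<mu> unfolding smooth_map_def V_def \<iota>_def by blast
    then show "smooth_on V (\<lambda>x. (\<iota> x, x))" by (intro smooth_on_Pair open_V smooth_on_ident)
  qed
  moreover have "frechet_derivative (mult_rep \<mu> \<kappa> \<epsilon>) (at (\<iota> x, x)) (0, u) = ?\<Phi> x" if x: "x \<in> V" for x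
  proof -
    define p where "p = chart_inv \<kappa> x"
    let ?L = "left_translation G (inv p)"
    have p: "p \<in> fst \<kappa>" "snd \<kappa> p = x" "?L p = \<one>"
      using V[OF x] unfolding p_def left_translation_def by simp_all
    have "(mult_rep \<mu> \<kappa> \<epsilon> has_derivative frechet_derivative (mult_rep \<mu> \<kappa> \<epsilon>) (at (\<iota> x, x))) (at (\<iota> x, x))"
      using smooth_on_imp_differentiable[OF smooth_mult_rep[OF \<mu> assms \<epsilon>(1)] mem[OF x]]
      by (simp add: frechet_derivative_works)
    moreover have "(Pair (\<iota> x) has_derivative Pair 0) (at x)"
      by (rule has_derivative_Pair) (auto intro: derivative_intros)
    ultimately have "(mult_rep \<mu> \<kappa> \<epsilon> \<circ> Pair (\<iota> x) has_derivative
        frechet_derivative (mult_rep \<mu> \<kappa> \<epsilon>) (at (\<iota> x, x)) \<circ> Pair 0) (at x)"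
      by (intro diff_chain_at)
    \<comment> \<open>Differentiating along \<open>(0, u)\<close> keeps the first factor at
      \<open>inv p\<close>, so what is differentiated is the translation by this fixed
      element.\<close>
    moreover have "mult_rep \<mu> \<kappa> \<epsilon> \<circ> Pair (\<iota> x) = local_rep \<kappa> \<epsilon> ?L"
      using V(4)[OF x] by (auto simp: mult_rep_def local_rep_def left_translation_def p_def)
    ultimately have "chart_deriv \<kappa> \<epsilon> ?L p = frechet_derivative (mult_rep \<mu> \<kappa> \<epsilon>) (at (\<iota> x, x)) \<circ> Pair 0"
      unfolding chart_deriv_def p(2) by (metis frechet_derivative_at)
    \<comment> \<open>Factoring through the identity map changes the source chart from
      \<open>\<kappa>\<close> to the preferred chart at \<open>p\<close>.\<close>
    moreover have "chart_deriv \<kappa> \<epsilon> (?L \<circ> id) p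
        = chart_deriv (chart_at A p) \<epsilon> ?L (id p) \<circ> chart_deriv \<kappa> (chart_at A p) id p"
      by (rule chart_deriv_compose[OF atlas atlas smooth_map_id[OF atlas] smooth_left_translation assms
            chart_at_in(1)[OF atlas] \<epsilon>(1) p(1)]) (simp_all add: p chart_at_in[OF atlas] \<epsilon>)
    ultimately have "frechet_derivative (mult_rep \<mu> \<kappa> \<epsilon>) (at (\<iota> x, x)) (0, u)
        = tangent_map A A ?L p (change_chart \<kappa> (chart_at A p) p u)"
      unfolding tangent_map_eq change_chart_eq p(3) \<epsilon>_def by (simp add: fun_eq_iff)
    then show ?thesis by (simp add: p_def Let_def)
  qed
  ultimately have "smooth_on V ?\<Phi>" by (rule smooth_on_cong[OF open_V, rotated])
  moreover have "x\<^sub>0 \<in> V"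
    using chart_apply_inv[OF x0] chart_at_in(2)[OF atlas] unfolding V_def \<mu>_def
    by (intro image_eqI[of _ _ "chart_inv \<kappa> x\<^sub>0"]) auto
  ultimately show "\<exists>U. open U \<and> x\<^sub>0 \<in> U \<and> smooth_on U ?\<Phi>" using open_V by blast
qed

section \<open>Left invariant extension of a form on the Lie algebra\<close>

definition left_invariant_extension :: "('e \<Rightarrow> 'e \<Rightarrow> real) \<Rightarrow> 'g \<Rightarrow> 'e \<Rightarrow> 'e \<Rightarrow> real" where
  "left_invariant_extension q p u v =
     q (tangent_map A A (left_translation G (inv p)) p u) (tangent_map A A (left_translation G (inv p)) p v)"

text \<open>Smoothness holds because \<open>q\<close> does not depend on the point and is applied to
  two smoothly trivialised vectors. Positivity comes from injectivity of the differentials of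
  translations.\<close>

lemma left_invariant_extension_metric:
  assumes "bounded_bilinear q" "\<And>u v. q u v = q v u" "\<And>u. u \<noteq> 0 \<Longrightarrow> q u u > 0"
  shows "left_invariant_riemannian_metric G A (left_invariant_extension q)"
  unfolding left_invariant_riemannian_metric_def riemannian_metric_def
proof (intro conjI allI impI ballI)
  fix p u v
  note T = bounded_linear_tangent_map[OF atlas atlas smooth_left_translation]
  show "bilinear (left_invariant_extension q p)"
    unfolding bilinear_def linear_iff left_invariant_extension_def
    using assms(1) T[of "inv p" p]
    by (simp add: bounded_bilinear.add_left bounded_bilinear.add_right bounded_bilinear.scaleR_left
        bounded_bilinear.scaleR_right linear_add linear_cmul bounded_linear.linear)
  show "left_invariant_extension q p u v = left_invariant_extension q p v u"
    unfolding left_invariant_extension_def by (rule assms(2))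
  show "left_invariant_extension q p u u > 0" if "u \<noteq> 0"
    unfolding left_invariant_extension_def
    using assms(3) tangent_left_translation_inj that by blast
  show "left_invariant_extension q (h \<otimes> p) (tangent_map A A (left_translation G h) p u)
      (tangent_map A A (left_translation G h) p v) = left_invariant_extension q p u v" for h
    unfolding left_invariant_extension_def tangent_left_translation_compose[of h p, symmetric] by simp
  show "smooth_on (snd \<kappa> ` fst \<kappa>) (\<lambda>x. let p = chart_inv \<kappa> x; T = change_chart \<kappa> (chart_at A p) p
      in left_invariant_extension q p (T u) (T v))" if "\<kappa> \<in> A" for \<kappa>
    using smooth_on_bounded_bilinear[OF assms(1) open_chart_range[OF atlas that]
        smooth_left_trivialisation[OF that, of u] smooth_left_trivialisation[OF that, of v]]
    unfolding left_invariant_extension_def Let_def .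
qed

text \<open>Translation by \<open>inv h\<close> carries \<open>X h\<close> to the value of
  \<open>X\<close> at the identity. The length of \<open>X\<close> is thus constant, and a single
  bound on it serves at all points.\<close>

lemma left_invariant_extension_field:
  assumes "left_invariant_vector_field G A X"
  shows "left_invariant_extension q h (X h) (X h) = q (X \<one>) (X \<one>)"
  using assms unfolding left_invariant_vector_field_def left_invariant_extension_def by simp

lemma left_invariant_extension_automorphism:
  assumes "\<psi> \<in> lie_aut G A"
    and "\<And>u v. q (tangent_map A A \<psi> \<one> u) (tangent_map A A \<psi> \<one> v) = q u v"
  shows "left_invariant_extension q (\<psi> p) (tangent_map A A \<psi> p u) (tangent_map A A \<psi> p v)
    = left_invariant_extension q p u v"
proof -
  have smooth: "smooth_map A A \<psi>" and hom: "\<psi> \<in> hom G G"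
    using assms(1) unfolding lie_aut_def diffeomorphism_def auto_def by auto
  have inv: "\<psi> (inv x) = inv (\<psi> x)" for x
    using group_hom.hom_inv[of G G \<psi> x] hom by (simp add: group_hom_def group_hom_axioms_def)
  \<comment> \<open>The homomorphism property as an equation of maps. Differentiated at
    \<open>p\<close>, it moves the claim to the identity, where \<open>\<psi>\<close> preserves
    \<open>q\<close>.\<close>
  have "left_translation G (inv (\<psi> p)) \<circ> \<psi> = \<psi> \<circ> left_translation G (inv p)"
    using hom by (auto simp: left_translation_def hom_def inv)
  then have "tangent_map A A (left_translation G (inv (\<psi> p))) (\<psi> p) \<circ> tangent_map A A \<psi> p
      = tangent_map A A \<psi> \<one> \<circ> tangent_map A A (left_translation G (inv p)) p"
    using tangent_map_compose[OF atlas atlas atlas smooth smooth_left_translation, of "inv (\<psi> p)" p]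
      tangent_map_compose[OF atlas atlas atlas smooth_left_translation smooth, of "inv p" p]
    by (simp add: left_translation_def[of G "inv p" ] )
  then show ?thesis
    unfolding left_invariant_extension_def by (metis assms(2) o_apply)
qed

section \<open>Differentials at the identity of a compact group of automorphisms\<close>

definition tangent_at_one :: "('g \<Rightarrow> 'g) \<Rightarrow> 'e \<Rightarrow>\<^sub>L 'e" where
  "tangent_at_one \<psi> = Blinfun (tangent_map A A \<psi> \<one>)"

lemma tangent_at_one_apply:
  "smooth_map A A \<psi> \<Longrightarrow> blinfun_apply (tangent_at_one \<psi>) = tangent_map A A \<psi> \<one>"
  unfolding tangent_at_one_def
  by (rule bounded_linear_Blinfun_apply[OF bounded_linear_tangent_map[OF atlas atlas]])

text \<open>The chain rule evaluates the outer differential at the image of the identity under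
  \<open>\<theta>\<close>, which is the identity again.\<close>

lemma tangent_at_one_compose:
  assumes "smooth_map A A \<psi>" "smooth_map A A \<theta>" "smooth_map A A (\<psi> \<circ> \<theta>)" "\<theta> \<one> = \<one>"
  shows "tangent_at_one (\<psi> \<circ> \<theta>) = tangent_at_one \<psi> o\<^sub>L tangent_at_one \<theta>"
  using tangent_map_compose[OF atlas atlas atlas assms(2,1), of \<one>]
  by (intro blinfun_eqI) (simp add: tangent_at_one_apply assms)

lemma lie_autD:
  assumes "\<psi> \<in> lie_aut G A"
  shows "smooth_map A A \<psi>" "\<psi> \<one> = \<one>"
proof -
  show "smooth_map A A \<psi>" using assms unfolding lie_aut_def diffeomorphism_def by simp
  have "\<psi> \<in> hom G G" using assms unfolding lie_aut_def auto_def by simp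
  then show "\<psi> \<one> = \<one>" by (rule hom_one[OF _ is_group is_group])
qed

text \<open>\<open>BijGroup\<close> restricts its maps to the carrier. The carrier is the whole type
  here, so its operations become plain composition and \<open>id\<close>.\<close>

lemma subgroup_AutoGroup_compose:
  assumes "subgroup K (AutoGroup G)"
  shows "\<psi> \<in> K \<Longrightarrow> \<theta> \<in> K \<Longrightarrow> \<psi> \<circ> \<theta> \<in> K" and "id \<in> K"
    and "\<psi> \<in> K \<Longrightarrow> \<exists>\<theta>\<in>K. \<psi> \<circ> \<theta> = id \<and> \<theta> \<circ> \<psi> = id"
proof -
  interpret Aut: group "AutoGroup G" by (rule AutoGroup)
  have one: "\<one>\<^bsub>AutoGroup G\<^esub> = id"
    by (simp add: AutoGroup_def BijGroup_def id_def restrict_def)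
  have mult: "\<psi> \<otimes>\<^bsub>AutoGroup G\<^esub> \<theta> = \<psi> \<circ> \<theta>" if "\<psi> \<in> K" "\<theta> \<in> K" for \<psi> \<theta>
  proof -
    have "\<psi> \<in> Bij (carrier G)" "\<theta> \<in> Bij (carrier G)"
      using that subgroup.subset[OF assms] by (auto simp: AutoGroup_def auto_def)
    then show ?thesis by (simp add: AutoGroup_def BijGroup_def compose_def restrict_def o_def)
  qed
  show "id \<in> K" using subgroup.one_closed[OF assms] by (simp add: one)
  show "\<psi> \<circ> \<theta> \<in> K" if "\<psi> \<in> K" "\<theta> \<in> K"
    using subgroup.m_closed[OF assms that] by (simp add: mult that)
  show "\<exists>\<theta>\<in>K. \<psi> \<circ> \<theta> = id \<and> \<theta> \<circ> \<psi> = id" if "\<psi> \<in> K"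
  proof (intro bexI conjI)
    let ?\<theta> = "inv\<^bsub>AutoGroup G\<^esub> \<psi>"
    have "\<psi> \<in> carrier (AutoGroup G)" using that subgroup.subset[OF assms] by blast
    then show "\<psi> \<circ> ?\<theta> = id" "?\<theta> \<circ> \<psi> = id"
      using Aut.r_inv Aut.l_inv subgroup.m_inv_closed[OF assms that] that
      by (simp_all add: one flip: mult)
    show "?\<theta> \<in> K" by (rule subgroup.m_inv_closed[OF assms that])
  qed
qed

text \<open>The topology on automorphisms is pulled back along this very map, which is therefore
  continuous into the operator norm topology.\<close>

lemma compact_tangent_at_one_image:
  assumes "compactin (lie_aut_topology G A) K"
  shows "compact (tangent_at_one ` K)"
proof -
  have "continuous_map (lie_aut_topology G A) euclidean (id \<circ> tangent_at_one)"
    unfolding lie_aut_topology_def tangent_at_one_def[abs_def]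
    by (rule continuous_map_pullback) simp
  then show ?thesis using image_compactin[OF assms, of euclidean tangent_at_one] by simp
qed

lemma invariant_inner_product_exists:
  assumes "subgroup K (AutoGroup G)" "K \<subseteq> lie_aut G A" "compactin (lie_aut_topology G A) K"
  shows "\<exists>q. bounded_bilinear q \<and> (\<forall>u v. q u v = q v u) \<and> (\<forall>u. u \<noteq> 0 \<longrightarrow> q u u > 0) \<and>
    (\<forall>\<psi>\<in>K. \<forall>u v. q (tangent_map A A \<psi> \<one> u) (tangent_map A A \<psi> \<one> v) = (q u v :: real))"
proof -
  obtain B :: "'e set" where B: "finite B" "span B = UNIV" using atlas unfolding smooth_atlas_def by blast
  note K = subgroup_AutoGroup_compose[OF assms(1)]
  have smooth: "smooth_map A A \<psi>" and one: "\<psi> \<one> = \<one>" if "\<psi> \<in> K" for \<psi>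
    using that assms(2) lie_autD by blast+
  have compose: "tangent_at_one \<psi> o\<^sub>L tangent_at_one \<theta> = tangent_at_one (\<psi> \<circ> \<theta>)"
    if "\<psi> \<in> K" "\<theta> \<in> K" for \<psi> \<theta>
    by (rule tangent_at_one_compose[symmetric]) (intro smooth one K(1) that)+
  have id: "tangent_at_one id = id_blinfun"
    by (rule blinfun_eqI) (simp add: tangent_at_one_apply smooth_map_id[OF atlas] tangent_map_id[OF atlas])
  have "\<exists>q :: 'e \<Rightarrow> 'e \<Rightarrow> real. bounded_bilinear q \<and> (\<forall>u v. q u v = q v u) \<and>
      (\<forall>u. u \<noteq> 0 \<longrightarrow> q u u > 0) \<and> (\<forall>k\<in>tangent_at_one ` K. \<forall>u v. q (k u) (k v) = q u v)"
  proof (rule compact_group_invariant_inner_product[OF B compact_tangent_at_one_image[OF assms(3)]])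
    show "id_blinfun \<in> tangent_at_one ` K" using K(2) id by (metis imageI)
    show "k o\<^sub>L l \<in> tangent_at_one ` K" if "k \<in> tangent_at_one ` K" "l \<in> tangent_at_one ` K" for k l
      using that K(1) by (auto simp: compose)
    show "\<exists>k'\<in>tangent_at_one ` K. k o\<^sub>L k' = id_blinfun \<and> k' o\<^sub>L k = id_blinfun"
      if k: "k \<in> tangent_at_one ` K" for k
    proof -
      obtain \<psi> where \<psi>: "\<psi> \<in> K" "k = tangent_at_one \<psi>" using k by blast
      obtain \<theta> where "\<theta> \<in> K" "\<psi> \<circ> \<theta> = id" "\<theta> \<circ> \<psi> = id" using K(3)[OF \<psi>(1)] by blast
      then show ?thesis
        using \<psi> id by (intro bexI[of _ "tangent_at_one \<theta>"] imageI) (simp_all add: compose)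
    qed
  qed
  then show ?thesis by (simp add: tangent_at_one_apply smooth)
qed

end

theorem proposition2p7:
  fixes G :: "('g::{t2_space,second_countable_topology}, 'm) monoid_scheme"
    and A :: "('g, 'e::real_inner) chart set"
    and X :: "'g \<Rightarrow> 'e"
    and K :: "('g \<Rightarrow> 'g) set"
  assumes "lie_group G A"
    and "simply_connected (UNIV :: 'g set)"
    and "left_invariant_vector_field G A X"
    and "subgroup K (AutoGroup G)"
    and "K \<subseteq> lie_aut_fixing G A X"
    and "compactin (lie_aut_topology G A) K"
  shows "\<exists>(F :: 'g \<Rightarrow> 'e \<Rightarrow> real) g b0 \<phi>.
           left_invariant_alpha_beta_metric G A X g b0 \<phi> F \<and>
           inj_on \<phi> {-b0<..<b0} \<and>
           K \<subseteq> lie_aut_fixing G A X \<inter> isometry_set A F"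
proof -
  interpret lie_group_atlas G A by unfold_locales (rule assms(1))
  have K: "K \<subseteq> lie_aut G A" using assms(5) unfolding lie_aut_fixing_def by blast
  obtain q :: "'e \<Rightarrow> 'e \<Rightarrow> real" where q: "bounded_bilinear q" "\<And>u v. q u v = q v u"
    "\<And>u. u \<noteq> 0 \<Longrightarrow> q u u > 0"
    and inv: "\<And>\<psi> u v. \<psi> \<in> K \<Longrightarrow> q (tangent_map A A \<psi> \<one>\<^bsub>G\<^esub> u) (tangent_map A A \<psi> \<one>\<^bsub>G\<^esub> v) = q u v"
    using invariant_inner_product_exists[OF assms(4) K assms(6)] by auto
  define g where "g = left_invariant_extension q"
  \<comment> \<open>Adding 1 makes the bound on the length of \<open>X\<close> strict and keeps
    \<open>b\<close> positive even if \<open>X\<close> vanishes.\<close>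
  define b where "b = sqrt (q (X \<one>\<^bsub>G\<^esub>) (X \<one>\<^bsub>G\<^esub>)) + 1"
  define F where "F = alpha_beta_metric g X (\<lambda>s. b + s)"
  have "q (X \<one>\<^bsub>G\<^esub>) (X \<one>\<^bsub>G\<^esub>) \<ge> 0"
    using q(3)[of "X \<one>\<^bsub>G\<^esub>"] by (cases "X \<one>\<^bsub>G\<^esub> = 0") (auto simp: bounded_bilinear.zero_left[OF q(1)])
  then have b: "b > 0" "\<And>h. sqrt (g h (X h) (X h)) < b"
    unfolding b_def g_def left_invariant_extension_field[OF assms(3)] by (simp_all add: add_nonneg_pos)
  have "left_invariant_alpha_beta_metric G A X g b (\<lambda>s. b + s) F"
    unfolding left_invariant_alpha_beta_metric_def
  proof (intro conjI allI)
    show "left_invariant_riemannian_metric G A g"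
      unfolding g_def by (rule left_invariant_extension_metric) (fact q)+
  qed (simp_all add: assms(3) alpha_beta_function_shift b F_def)
  moreover have "inj_on (\<lambda>s. b + s) {-b<..<b}" by (simp add: inj_on_def)
  moreover have "K \<subseteq> isometry_set A F"
  proof
    fix \<psi> assume \<psi>: "\<psi> \<in> K"
    have diffeo: "diffeomorphism A \<psi>" using \<psi> K unfolding lie_aut_def by blast
    have X: "X (\<psi> p) = tangent_map A A \<psi> p (X p)" for p
      using \<psi> assms(5) unfolding lie_aut_fixing_def by auto
    have g: "g (\<psi> p) (tangent_map A A \<psi> p u) (tangent_map A A \<psi> p v) = g p u v" for p u v
      unfolding g_def
    proof (rule left_invariant_extension_automorphism)
      show "\<psi> \<in> lie_aut G A" using \<psi> K by blast
    qed (rule inv[OF \<psi>])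
    have "tangent_map A A \<psi> p 0 = 0" for p
      by (rule linear_0[OF bounded_linear.linear[OF bounded_linear_tangent_map[OF atlas atlas]]])
        (use diffeo in \<open>simp add: diffeomorphism_def\<close>)
    \<comment> \<open>Both sides of the invariance equation thus fall into the same case of
      \<open>alpha_beta_metric\<close>.\<close>
    then have "tangent_map A A \<psi> p y = 0 \<longleftrightarrow> y = 0" for p y
      using tangent_map_diffeomorphism_eq_0[OF atlas diffeo] by auto
    then have "F (\<psi> p) (tangent_map A A \<psi> p y) = F p y" for p y
      unfolding F_def alpha_beta_metric_def X by (simp add: g)
    then show "\<psi> \<in> isometry_set A F" using diffeo unfolding isometry_set_def by blast
  qed
  ultimately show ?thesis using assms(5) by blast
qed

end
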